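(* Let $(\boldsymbol{X}^{\delta t}_t)_{t\in\mathbb{Z}}$ be the $\mathbb{R}^d$-valued discrete-time process obtained from the numerical scheme for the stochastic differential equation or stochastic delay differential equation described in the context, and let $\sigma:\mathbb{R}\to\mathbb{R}$ be a nonconstant, continuous function with bounded image. Define a filter $\boldsymbol{U}:((\mathbb{R}^d)^{\mathbb{Z}},\otimes_{t\in\mathbb{Z}}\mathcal{B}(\mathbb{R}^d))\to((\mathbb{R}^d)^{\mathbb{Z}},\otimes_{t\in\mathbb{Z}}\mathcal{B}(\mathbb{R}^d))$ by $\boldsymbol{U}((\boldsymbol{X}^{\delta t}_t)_{t\in\mathbb{Z}})_t=\boldsymbol{X}^{\delta t}_{t+1}$, with associated functional $\boldsymbol{H}$, so that $\boldsymbol{H}((\boldsymbol{X}^{\delta t}_t)^{(1)})=\boldsymbol{X}^{\delta t}_{t+1}$, where $(\boldsymbol{X}^{\delta t}_t)^{(1)}:=(\dots,\boldsymbol{X}^{\delta t}_{t-1},\boldsymbol{X}^{\delta t}_t)$ is a fixed $\mathbb{R}^d$-valued input process. Then for arbitrary $\varepsilon>0$ there exist $N\in\mathbb{N}$, $W_{in}\in\mathbb{M}_{N,d}$, $\boldsymbol{\zeta}\in\mathbb{R}^N$, $A\in\mathbb{M}_N$ and $\boldsymbol{w}\in\mathbb{M}_{N,d}$ such that the echo state network $$\boldsymbol{r}_t=\sigma(A\boldsymbol{r}_{t-1}+W_{in}\boldsymbol{z}_t+\boldsymbol{\zeta}),\qquad \boldsymbol{y}_t=\boldsymbol{w}^T\boldsymbol{r}_t,\qquad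 t\in\mathbb{Z},$$ has the echo state property, the corresponding filter is causal and time-invariant, the associated functional $\boldsymbol{H}^{A,W_{in},\boldsymbol{\zeta}}_{\boldsymbol{w}}$ satisfies $\boldsymbol{H}^{A,W_{in},\boldsymbol{\zeta}}_{\boldsymbol{w}}((\boldsymbol{X}^{\delta t}_t)^{(1)})\in L^2(\Omega,\mathcal{F},\mathbb{P})$, and $$\|\boldsymbol{H}((\boldsymbol{X}^{\delta t}_t)^{(1)})-\boldsymbol{H}^{A,W_{in},\boldsymbol{\zeta}}_{\boldsymbol{w}}((\boldsymbol{X}^{\delta t}_t)^{(1)})\|_2<\varepsilon .$$ Additionally, for every $s\in\mathbb{Z}$, considering the input sequences $(\boldsymbol{X}^{\delta t}_t)^{(1)}$ and $T_{-s}((\boldsymbol{X}^{\delta t}_t)^{(1)})=(\dots,\boldsymbol{X}^{\delta t}_{t+s-1},\boldsymbol{X}^{\delta t}_{t+s})$, there exist causal and time-invariant echo state network filters $\boldsymbol{U}'$ and $\boldsymbol{U}^{s'}$, constructed by the input sequences $(\boldsymbol{X}^{\delta t}_t)^{(1)}$ and $T_{-s}((\boldsymbol{X}^{\delta t}_t)^{(1)})$ respectively, that are identical in the $L^2$-sense: for every $\varepsilon>0$ such filters can be chosen with $\|\boldsymbol{U}'((\boldsymbol{X}^{\delta t}_t)_{t\in\mathbb{Z}})_s-\boldsymbol{U}^{s'}((\boldsymbol{X}^{\delta t}_t)_{t\in\mathbb{Z}})_s\|_2<\varepsilon$.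
   Context: The process. On a probability space $(\Omega,\mathcal{F},\mathbb{P})$ with a $d$-dimensional standard Brownian motion $\boldsymbol{B}$, $\boldsymbol{X}$ on $[0,T]$ solves either the SDE $d\boldsymbol{X}_t=\boldsymbol{f}(\boldsymbol{X}_t)dt+\boldsymbol{g}\,d\boldsymbol{B}_t$, or the SDDE $d\boldsymbol{X}_t=\boldsymbol{f}(\boldsymbol{X}_t,\boldsymbol{X}_{t-\tau})dt+\boldsymbol{g}\,d\boldsymbol{B}_t$ for $t>0$, $\boldsymbol{X}_t=\boldsymbol{\gamma}_{-t}$ for $t\in[-\tau,0]$, with delay $\tau>0$ and $\boldsymbol{\gamma}:[0,\tau]\to\mathbb{R}^d$. Here $\boldsymbol{g}$ is a constant diagonal matrix with positive diagonal entries, and the coefficients satisfy Lipschitz and growth conditions, so that solutions exist, are unique, and $\boldsymbol{X}_t\in L^2(\Omega,\mathcal{F},\mathbb{P})$. The numerical solution with (maximal) time step $\delta t$ is given by the Euler-Maruyama scheme $\boldsymbol{X}_{t+\delta t}=\boldsymbol{X}_t+\boldsymbol{f}(\boldsymbol{X}_t)\delta t+\boldsymbol{g}\,\delta\boldsymbol{B}_t$, $\delta\boldsymbol{B}_t\sim N(\boldsymbol{0},\delta t\,\boldsymbol{I})$ (with $\boldsymbol{f}(\boldsymbol{X}_t,\boldsymbol{X}_{t-\tau})$ in place of $\boldsymbol{f}(\boldsymbol{X}_t)$ for the SDDE). From this one forms a countably infinite time-ordered discrete sequence with respect to the process $\boldsymbol{X}$ for times in $[0,T]$, $(\boldsymbol{X}^{\delta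 t}_t)_{t\in\mathbb{Z}}=(\dots,\boldsymbol{X}^{\delta t}_{t-1},\boldsymbol{X}^{\delta t}_t,\boldsymbol{X}^{\delta t}_{t+1},\dots)$, indexed by $\mathbb{Z}$ (consecutive entries being consecutive values of the scheme), with $\boldsymbol{X}^{\delta t}_t\in L^2(\Omega,\mathcal{F},\mathbb{P})$ for all $t\in\mathbb{Z}$. Notation. $\mathbb{Z}_-=\{\dots,-1,0\}$; $\mathbb{M}_{n,m}$ is the space of real $n\times m$ matrices, $\mathbb{M}_n=\mathbb{M}_{n,n}$; $\|\cdot\|_2$ is the norm of $L^2(\Omega,\mathcal{F},\mathbb{P})$ for $\mathbb{R}^d$-valued random variables. A ($d$-dimensional) filter is a measurable map $\boldsymbol{U}:(\mathbb{R}^d)^{\mathbb{Z}}\to(\mathbb{R}^d)^{\mathbb{Z}}$; it is causal if $\boldsymbol{U}(\boldsymbol{z})_t=\boldsymbol{U}(\boldsymbol{z}')_t$ whenever $\boldsymbol{z}_s=\boldsymbol{z}'_s$ for all $s\le t$, and time-invariant if $T_{-s}\circ\boldsymbol{U}=\boldsymbol{U}\circ T_{-s}$ for all $s\in\mathbb{Z}$, where $T_{-s}(\boldsymbol{z})_t:=\boldsymbol{z}_{t+s}$. The functional associated with a causal time-invariant filter $\boldsymbol{U}$ is $\boldsymbol{H}_{\boldsymbol{U}}(\boldsymbol{z}):=\boldsymbol{U}(\boldsymbol{z}^e)_0$ for $\boldsymbol{z}\in(\mathbb{R}^d)^{\mathbb{Z}_-}$, $\boldsymbol{z}^e$ an arbitrary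 extension of $\boldsymbol{z}$ to $(\mathbb{R}^d)^{\mathbb{Z}}$; a semi-infinite sequence such as $(\dots,\boldsymbol{X}^{\delta t}_{t-1},\boldsymbol{X}^{\delta t}_t)$ is regarded as indexed by $\mathbb{Z}_-$ with its last entry at index $0$. Echo state networks. In the displayed system $\sigma$ acts componentwise, $(\boldsymbol{z}_t)$ is the input and $(\boldsymbol{y}_t)$ the output. The echo state property means: for every $\boldsymbol{z}\in(\mathbb{R}^d)^{\mathbb{Z}}$ there is a unique $\boldsymbol{r}\in(\mathbb{R}^N)^{\mathbb{Z}}$ satisfying the first equation. An echo state network filter is the map $\boldsymbol{z}\mapsto\boldsymbol{y}$ of a network of this form with the echo state property. Such a causal time-invariant filter $\boldsymbol{V}$ with functional $\boldsymbol{H}_{\boldsymbol{V}}$ is "constructed by" a semi-infinite input sequence $\boldsymbol{Y}$ if, for the given $\varepsilon$, $\boldsymbol{H}_{\boldsymbol{V}}(\boldsymbol{Y})\in L^2$ and $\|\boldsymbol{H}(\boldsymbol{Y})-\boldsymbol{H}_{\boldsymbol{V}}(\boldsymbol{Y})\|_2<\varepsilon$, where $\boldsymbol{H}((\dots,\boldsymbol{X}^{\delta t}_{t+s-1},\boldsymbol{X}^{\delta t}_{t+s}))=\boldsymbol{X}^{\delta t}_{t+s+1}$.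
   Formalization: The one-step-ahead shift is not causal and has no associated functional (the next value need not depend on the past); the formal theorem assumes a measurable causal time-invariant filter U with U(X)_t = X_{t+1} almost surely for all t, and takes H as its functional. *)

theory Defs
  imports "HOL-Probability.Probability"
begin

definition in_L2 :: "'w measure \<Rightarrow> ('w \<Rightarrow> real ^ 'd) \<Rightarrow> bool" where
  "in_L2 M Z \<longleftrightarrow> Z \<in> borel_measurable M \<and> integrable M (\<lambda>\<omega>. (norm (Z \<omega>))\<^sup>2)"

text \<open>Meaningful only for \<^term>\<open>Z\<close> with \<^term>\<open>in_L2 M Z\<close>; the Bochner integral is 0 otherwise.\<close>

definition norm_L2 :: "'w measure \<Rightarrow> ('w \<Rightarrow> real ^ 'd) \<Rightarrow> real" where
  "norm_L2 M Z = sqrt (\<integral>\<omega>. (norm (Z \<omega>))\<^sup>2 \<partial>M)"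

text \<open>Normal increments with covariance \<open>(t - s) I\<close>: the coordinates are independent
  with law \<open>N(0, t - s)\<close>. (\<^const>\<open>normal_density\<close> takes the standard deviation.)\<close>

definition brownian_motion :: "'w measure \<Rightarrow> (real \<Rightarrow> 'w \<Rightarrow> real ^ 'd) \<Rightarrow> bool" where
  "brownian_motion M B \<longleftrightarrow>
     (\<forall>t\<ge>0. B t \<in> borel_measurable M) \<and>
     (AE \<omega> in M. B 0 \<omega> = 0) \<and>
     (AE \<omega> in M. continuous_on {0..} (\<lambda>t. B t \<omega>)) \<and>
     (\<forall>(n::nat) (u::nat \<Rightarrow> real). 0 \<le> u 0 \<and> (\<forall>i<n. u i < u (Suc i)) \<longrightarrow>
        prob_space.indep_vars M (\<lambda>_. borel) (\<lambda>i \<omega>. B (u (Suc i)) \<omega> - B (u i) \<omega>) {..<n}) \<and>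
     (\<forall>s t. 0 \<le> s \<and> s < t \<longrightarrow>
        prob_space.indep_vars M (\<lambda>_. borel) (\<lambda>i \<omega>. (B t \<omega> - B s \<omega>) $ i) UNIV \<and>
        (\<forall>i. distributed M lborel (\<lambda>\<omega>. (B t \<omega> - B s \<omega>) $ i)
               (\<lambda>x. ennreal (normal_density 0 (sqrt (t - s)) x))))"

definition positive_diagonal :: "real ^ 'd ^ 'd \<Rightarrow> bool" where
  "positive_diagonal g \<longleftrightarrow> (\<forall>i j. i \<noteq> j \<longrightarrow> g $ i $ j = 0) \<and> (\<forall>i. g $ i $ i > 0)"

definition lipschitz_growth :: "('a::real_normed_vector \<Rightarrow> 'b::real_normed_vector) \<Rightarrow> bool" where
  "lipschitz_growth f \<longleftrightarrow>
     (\<exists>L. L-lipschitz_on UNIV f) \<and> (\<exists>K. \<forall>x. norm (f x) \<le> K * (1 + norm x))"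

text \<open>Since \<open>g\<close> is constant, the stochastic integral of \<open>g\<close> up to time \<open>t\<close> is \<open>g B\<^sub>t\<close>, so the
  integral form of the equation can be read pathwise.\<close>

definition solves_sde ::
    "'w measure \<Rightarrow> real \<Rightarrow> (real ^ 'd \<Rightarrow> real ^ 'd) \<Rightarrow> real ^ 'd ^ 'd \<Rightarrow>
     (real \<Rightarrow> 'w \<Rightarrow> real ^ 'd) \<Rightarrow> (real \<Rightarrow> 'w \<Rightarrow> real ^ 'd) \<Rightarrow> bool" where
  "solves_sde M T f g B X \<longleftrightarrow>
     (\<forall>t\<in>{0..T}. in_L2 M (X t)) \<and>
     (AE \<omega> in M. continuous_on {0..T} (\<lambda>t. X t \<omega>) \<and>
        (\<forall>t\<in>{0..T}. set_integrable lborel {0..t} (\<lambda>s. f (X s \<omega>)) \<and>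
           X t \<omega> = X 0 \<omega> + (LINT s:{0..t}|lborel. f (X s \<omega>)) + g *v B t \<omega>))"

definition solves_sdde ::
    "'w measure \<Rightarrow> real \<Rightarrow> real \<Rightarrow> (real \<Rightarrow> real ^ 'd) \<Rightarrow>
     ((real ^ 'd) \<times> (real ^ 'd) \<Rightarrow> real ^ 'd) \<Rightarrow> real ^ 'd ^ 'd \<Rightarrow>
     (real \<Rightarrow> 'w \<Rightarrow> real ^ 'd) \<Rightarrow> (real \<Rightarrow> 'w \<Rightarrow> real ^ 'd) \<Rightarrow> bool" where
  "solves_sdde M T \<tau> \<gamma> f g B X \<longleftrightarrow>
     (\<forall>t\<in>{0..T}. in_L2 M (X t)) \<and>
     (\<forall>t\<in>{-\<tau>..0}. \<forall>\<omega>. X t \<omega> = \<gamma> (- t)) \<and>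
     (AE \<omega> in M. continuous_on {0..T} (\<lambda>t. X t \<omega>) \<and>
        (\<forall>t\<in>{0..T}. set_integrable lborel {0..t} (\<lambda>s. f (X s \<omega>, X (s - \<tau>) \<omega>)) \<and>
           X t \<omega> = X 0 \<omega> + (LINT s:{0..t}|lborel. f (X s \<omega>, X (s - \<tau>) \<omega>)) + g *v B t \<omega>))"

text \<open>The bounded interval \<open>[0, T]\<close> contains no sequence of times indexed by the integers with
  a constant step; \<open>dt\<close> is the maximal step.\<close>

definition time_grid :: "real \<Rightarrow> real \<Rightarrow> (int \<Rightarrow> real) \<Rightarrow> bool" where
  "time_grid T dt \<theta> \<longleftrightarrow> strict_mono \<theta> \<and> (\<forall>k. \<theta> k \<in> {0..T} \<and> \<theta> (k + 1) - \<theta> k \<le> dt)"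

definition euler_maruyama_sde ::
    "'w measure \<Rightarrow> (real ^ 'd \<Rightarrow> real ^ 'd) \<Rightarrow> real ^ 'd ^ 'd \<Rightarrow>
     (real \<Rightarrow> 'w \<Rightarrow> real ^ 'd) \<Rightarrow> (int \<Rightarrow> real) \<Rightarrow> (int \<Rightarrow> 'w \<Rightarrow> real ^ 'd) \<Rightarrow> bool" where
  "euler_maruyama_sde M f g B \<theta> Y \<longleftrightarrow>
     (\<forall>k. AE \<omega> in M. Y (k + 1) \<omega> =
        Y k \<omega> + (\<theta> (k + 1) - \<theta> k) *\<^sub>R f (Y k \<omega>) + g *v (B (\<theta> (k + 1)) \<omega> - B (\<theta> k) \<omega>))"

text \<open>\<open>Z\<close> is the numerical solution as a function of time. The delayed time \<open>\<theta> k - \<tau>\<close> may be a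
  positive time off the grid; the interpolation used there is not prescribed.\<close>

definition euler_maruyama_sdde ::
    "'w measure \<Rightarrow> real \<Rightarrow> real \<Rightarrow> (real \<Rightarrow> real ^ 'd) \<Rightarrow>
     ((real ^ 'd) \<times> (real ^ 'd) \<Rightarrow> real ^ 'd) \<Rightarrow> real ^ 'd ^ 'd \<Rightarrow>
     (real \<Rightarrow> 'w \<Rightarrow> real ^ 'd) \<Rightarrow> (int \<Rightarrow> real) \<Rightarrow> (int \<Rightarrow> 'w \<Rightarrow> real ^ 'd) \<Rightarrow> bool" where
  "euler_maruyama_sdde M T \<tau> \<gamma> f g B \<theta> Y \<longleftrightarrow>
     (\<exists>Z :: real \<Rightarrow> 'w \<Rightarrow> real ^ 'd.
        (\<forall>t\<in>{-\<tau>..T}. Z t \<in> borel_measurable M) \<and>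
        (\<forall>t\<in>{-\<tau>..0}. \<forall>\<omega>. Z t \<omega> = \<gamma> (- t)) \<and>
        (\<forall>k. Y k = Z (\<theta> k)) \<and>
        (\<forall>k. AE \<omega> in M. Z (\<theta> (k + 1)) \<omega> =
           Z (\<theta> k) \<omega> + (\<theta> (k + 1) - \<theta> k) *\<^sub>R f (Z (\<theta> k) \<omega>, Z (\<theta> k - \<tau>) \<omega>)
             + g *v (B (\<theta> (k + 1)) \<omega> - B (\<theta> k) \<omega>)))"

definition seq_filter :: "((int \<Rightarrow> real ^ 'd) \<Rightarrow> (int \<Rightarrow> real ^ 'd)) \<Rightarrow> bool" where
  "seq_filter U \<longleftrightarrow> U \<in> Pi\<^sub>M UNIV (\<lambda>_. borel) \<rightarrow>\<^sub>M Pi\<^sub>M UNIV (\<lambda>_. borel)"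

definition causal :: "((int \<Rightarrow> real ^ 'd) \<Rightarrow> (int \<Rightarrow> real ^ 'd)) \<Rightarrow> bool" where
  "causal U \<longleftrightarrow> (\<forall>z z' t. (\<forall>s\<le>t. z s = z' s) \<longrightarrow> U z t = U z' t)"

text \<open>\<open>time_shift s\<close> is the operator usually written \<open>T\<close> with index \<open>-s\<close>.\<close>

definition time_shift :: "int \<Rightarrow> (int \<Rightarrow> 'a) \<Rightarrow> (int \<Rightarrow> 'a)" where
  "time_shift s z = (\<lambda>t. z (t + s))"

definition time_invariant :: "((int \<Rightarrow> real ^ 'd) \<Rightarrow> (int \<Rightarrow> real ^ 'd)) \<Rightarrow> bool" where
  "time_invariant U \<longleftrightarrow> (\<forall>s. time_shift s \<circ> U = U \<circ> time_shift s)"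

text \<open>Sequences indexed by the nonpositive integers are functions on \<^typ>\<open>int\<close> whose values at
  positive arguments are irrelevant.\<close>

definition filter_functional ::
    "((int \<Rightarrow> real ^ 'd) \<Rightarrow> (int \<Rightarrow> real ^ 'd)) \<Rightarrow> (int \<Rightarrow> real ^ 'd) \<Rightarrow> real ^ 'd" where
  "filter_functional U z = U (SOME ze. \<forall>k\<le>0. ze k = z k) 0"

lemma filter_functional_extension:
  assumes "causal U" and "\<forall>k\<le>0. ze k = z k"
  shows "filter_functional U z = U ze 0"
proof -
  define e where "e = (SOME ze. \<forall>k\<le>0. ze k = z k)"
  have "\<forall>k\<le>0. e k = z k"
    unfolding e_def by (rule someI [of "\<lambda>ze. \<forall>k\<le>0. ze k = z k" ze]) (rule assms(2))
  then have "\<forall>k\<le>0. e k = ze k"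
    using assms(2) by simp
  with assms(1) have "U e 0 = U ze 0"
    unfolding causal_def by blast
  then show ?thesis
    by (simp add: filter_functional_def e_def)
qed

text \<open>The semi-infinite sequence of the values up to time \<open>t\<close>, re-indexed so that its last
  entry has index 0.\<close>

definition past :: "(int \<Rightarrow> 'w \<Rightarrow> real ^ 'd) \<Rightarrow> int \<Rightarrow> 'w \<Rightarrow> (int \<Rightarrow> real ^ 'd)" where
  "past Y t \<omega> = restrict (\<lambda>k. Y (t + k) \<omega>) {..0}"

text \<open>Vectors in \<open>\<real>\<^sup>N\<close> and matrices with an index running over \<open>1, \<dots>, N\<close> are functions on
  \<^typ>\<open>nat\<close> of which only the values at arguments below \<open>N\<close> matter; the index over the input
  dimension has type \<^typ>\<open>'d\<close>. States are taken in \<^const>\<open>extensional\<close> form, so that uniqueness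
  of the state sequence is uniqueness in \<open>\<real>\<^sup>N\<close>.\<close>

definition esn_states ::
    "(real \<Rightarrow> real) \<Rightarrow> nat \<Rightarrow> (nat \<Rightarrow> nat \<Rightarrow> real) \<Rightarrow> (nat \<Rightarrow> 'd::finite \<Rightarrow> real) \<Rightarrow> (nat \<Rightarrow> real) \<Rightarrow>
     (int \<Rightarrow> real ^ 'd) \<Rightarrow> (int \<Rightarrow> nat \<Rightarrow> real) \<Rightarrow> bool" where
  "esn_states \<sigma> N A Win \<zeta> z r \<longleftrightarrow>
     (\<forall>t. r t \<in> extensional {..<N}) \<and>
     (\<forall>t. \<forall>i<N. r t i =
        \<sigma> ((\<Sum>j<N. A i j * r (t - 1) j) + (\<Sum>k\<in>UNIV. Win i k * z t $ k) + \<zeta> i))"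

definition echo_state_property ::
    "(real \<Rightarrow> real) \<Rightarrow> nat \<Rightarrow> (nat \<Rightarrow> nat \<Rightarrow> real) \<Rightarrow> (nat \<Rightarrow> 'd::finite \<Rightarrow> real) \<Rightarrow> (nat \<Rightarrow> real) \<Rightarrow>
     bool" where
  "echo_state_property \<sigma> N A Win \<zeta> \<longleftrightarrow> (\<forall>z. \<exists>!r. esn_states \<sigma> N A Win \<zeta> z r)"

definition esn_filter ::
    "(real \<Rightarrow> real) \<Rightarrow> nat \<Rightarrow> (nat \<Rightarrow> nat \<Rightarrow> real) \<Rightarrow> (nat \<Rightarrow> 'd::finite \<Rightarrow> real) \<Rightarrow> (nat \<Rightarrow> real) \<Rightarrow>
     (nat \<Rightarrow> 'd \<Rightarrow> real) \<Rightarrow> (int \<Rightarrow> real ^ 'd) \<Rightarrow> (int \<Rightarrow> real ^ 'd)" where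
  "esn_filter \<sigma> N A Win \<zeta> w z =
     (\<lambda>t. \<chi> k. \<Sum>i<N. w i k * (THE r. esn_states \<sigma> N A Win \<zeta> z r) t i)"

definition is_esn_filter ::
    "(real \<Rightarrow> real) \<Rightarrow> ((int \<Rightarrow> real ^ 'd) \<Rightarrow> (int \<Rightarrow> real ^ 'd)) \<Rightarrow> bool" where
  "is_esn_filter \<sigma> V \<longleftrightarrow>
     (\<exists>N A Win \<zeta> w. 0 < N \<and> echo_state_property \<sigma> N A Win \<zeta> \<and> V = esn_filter \<sigma> N A Win \<zeta> w) \<and>
     seq_filter V"

definition constructed_by ::
    "'w measure \<Rightarrow> real \<Rightarrow> ((int \<Rightarrow> real ^ 'd) \<Rightarrow> real ^ 'd) \<Rightarrow> ('w \<Rightarrow> int \<Rightarrow> real ^ 'd) \<Rightarrow>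
     ((int \<Rightarrow> real ^ 'd) \<Rightarrow> (int \<Rightarrow> real ^ 'd)) \<Rightarrow> bool" where
  "constructed_by M \<epsilon> H P V \<longleftrightarrow>
     in_L2 M (\<lambda>\<omega>. filter_functional V (P \<omega>)) \<and>
     norm_L2 M (\<lambda>\<omega>. H (P \<omega>) - filter_functional V (P \<omega>)) < \<epsilon>"

end

theory Submission
  imports Defs
begin

text \<open>For a causal time-invariant filter, the functional evaluated at the past up to time \<open>t\<close> is
  the value of the filter at time \<open>t\<close>. Hence the target is a square integrable function of the past
  inputs, and it suffices to show that readouts of networks with strictly lower triangular
  connectivity (which trivially have the echo state property) are dense in \<open>L\<^sup>2\<close> of every law on the
  past. A network approximating for finitely many laws simultaneously then gives both claims at once.

  Density rests on closures under linear combinations and bounded pointwise limits. In one variable,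
  dilates and translates of \<open>\<sigma>\<close> generate all cosines: averaging a second difference of \<open>\<sigma>\<close> over
  dilations yields a nonzero continuous integrable function \<open>\<Psi>\<close>, and integrating the translates of
  \<open>\<Psi>\<close> against \<open>cos (\<xi> b)\<close>, where \<open>\<xi>\<close> is a nonzero frequency of \<open>\<Psi>\<close>, produces \<open>cos (\<xi> x)\<close>.
  Consequently a network can compute the cosine of \<open>h + W z\<^sub>0\<close>, where \<open>h\<close> is any delayed
  approximable functional. As \<open>n sin (h / n)\<close> tends to \<open>h\<close>, linear functionals of earlier
  inputs can be passed on exactly in the limit, so all cosines of linear functionals of the past are
  approximable. These cosines generate, by products, signs and limits, the indicators of all events
  of the past.\<close>

subsection \<open>Bounded pointwise closures\<close>

text \<open>The limit clause asks for a uniform bound and for convergence at every point, with no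
  measure involved. Dominated convergence then applies under every probability law and against any
  fixed integrable weight, so one notion serves both the real line and all laws on paths.\<close>

inductive_set bp_closure :: "('a \<Rightarrow> real) set \<Rightarrow> ('a \<Rightarrow> real) set" for F where
  base: "f \<in> F \<Longrightarrow> f \<in> bp_closure F"
| add: "f \<in> bp_closure F \<Longrightarrow> g \<in> bp_closure F \<Longrightarrow> (\<lambda>x. f x + g x) \<in> bp_closure F"
| scale: "f \<in> bp_closure F \<Longrightarrow> (\<lambda>x. c * f x) \<in> bp_closure F"
| limit: "(\<And>n. g n \<in> bp_closure F) \<Longrightarrow> (\<And>n x. \<bar>g n x\<bar> \<le> C) \<Longrightarrow>
    (\<And>x. (\<lambda>n::nat. g n x) \<longlonglongrightarrow> h x) \<Longrightarrow> h \<in> bp_closure F"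

lemma bp_closure_diff:
  assumes "f \<in> bp_closure F" "g \<in> bp_closure F"
  shows "(\<lambda>x. f x - g x) \<in> bp_closure F"
  using bp_closure.add[OF assms(1) bp_closure.scale[OF assms(2), of "-1"]] by simp

lemma bp_closure_mult_right:
  "f \<in> bp_closure F \<Longrightarrow> (\<lambda>x. f x * c) \<in> bp_closure F"
  using bp_closure.scale[of f F c] by (simp add: mult.commute)

lemma bp_closure_zero: "F \<noteq> {} \<Longrightarrow> (\<lambda>x. 0) \<in> bp_closure F"
  using bp_closure.scale[OF bp_closure.base, of _ F 0] by auto

lemma bp_closure_sum:
  assumes "finite I" "F \<noteq> {}" "\<And>i. i \<in> I \<Longrightarrow> f i \<in> bp_closure F"
  shows "(\<lambda>x. \<Sum>i\<in>I. f i x) \<in> bp_closure F"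
  using assms(1,3)
proof (induction I rule: finite_induct)
  case empty
  show ?case using bp_closure_zero[OF assms(2)] by simp
next
  case (insert i I)
  then show ?case using bp_closure.add[of "f i" F "\<lambda>x. \<Sum>i\<in>I. f i x"] by simp
qed

text \<open>Precomposition commutes with sums, multiples and bounded limits, so only generators need
  checking. This carries closure facts from the real line over to functionals of paths.\<close>

lemma bp_closure_compose:
  assumes "f \<in> bp_closure F" "\<And>f. f \<in> F \<Longrightarrow> (\<lambda>x. f (u x)) \<in> bp_closure G"
  shows "(\<lambda>x. f (u x)) \<in> bp_closure G"
  using assms(1)
proof induction
  case (limit g C h)
  show ?case by (rule bp_closure.limit[OF limit.IH, where C = C]) (use limit.hyps in auto)
qed (auto intro: bp_closure.intros assms(2))

lemma bp_closure_trans: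
  assumes "f \<in> bp_closure F" "F \<subseteq> bp_closure G"
  shows "f \<in> bp_closure G"
  using bp_closure_compose[of f F "\<lambda>x. x" G] assms by auto

lemma bp_closure_bounded:
  assumes "f \<in> bp_closure F" "\<And>f. f \<in> F \<Longrightarrow> \<exists>C. \<forall>x. \<bar>f x\<bar> \<le> C"
  shows "\<exists>C. \<forall>x. \<bar>f x\<bar> \<le> C"
  using assms(1)
proof induction
  case (add f g)
  then obtain C D where "\<And>x. \<bar>f x\<bar> \<le> C" "\<And>x. \<bar>g x\<bar> \<le> D" by blast
  then have "\<And>x. \<bar>f x + g x\<bar> \<le> C + D" by (meson abs_triangle_ineq add_mono order_trans)
  then show ?case by blast
next
  case (scale f c)
  then obtain C where "\<And>x. \<bar>f x\<bar> \<le> C" by blast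
  then have "\<And>x. \<bar>c * f x\<bar> \<le> \<bar>c\<bar> * C" by (simp add: abs_mult mult_left_mono)
  then show ?case by blast
next
  case (limit g C h)
  have "\<bar>h x\<bar> \<le> C" for x
    by (rule LIMSEQ_le_const2[OF tendsto_rabs[OF limit.hyps(3)]]) (use limit.hyps(2) in auto)
  then show ?case by blast
qed (use assms(2) in auto)

lemma bp_closure_measurable:
  assumes "f \<in> bp_closure F" "\<And>f. f \<in> F \<Longrightarrow> f \<in> borel_measurable M"
  shows "f \<in> borel_measurable M"
  using assms(1)
proof induction
  case (limit g C h)
  show ?case by (rule borel_measurable_LIMSEQ_real[OF limit.hyps(3) limit.IH])
qed (auto simp: assms(2))

text \<open>Equal-step sums form an ordinary sequence of finite linear combinations, the kind of
  limit that \<open>bp_closure\<close> admits. On each cell the mean value theorem for the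
  antiderivative \<open>G\<close> compares the left-endpoint term with the exact contribution, and
  uniform continuity bounds the difference.\<close>

lemma riemann_sums_tendsto:
  fixes g :: "real \<Rightarrow> real"
  assumes "a \<le> b" and g: "continuous_on {a..b} g"
  shows "(\<lambda>n. \<Sum>i<Suc n. (b - a) / Suc n * g (a + i * ((b - a) / Suc n))) \<longlonglongrightarrow> integral {a..b} g"
proof (rule LIMSEQ_I)
  fix e :: real assume "e > 0"
  \<comment> \<open>The \<open>+ 1\<close> keeps the denominator positive when \<open>a = b\<close>
    and makes the final bound \<open>(b - a) * e' < e\<close> strict.\<close>
  define e' where "e' = e / (b - a + 1)"
  have "e' > 0" using \<open>e > 0\<close> assms(1) by (simp add: e'_def)
  have "uniformly_continuous_on {a..b} g"
    using g by (intro compact_uniformly_continuous) auto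
  then obtain d where "d > 0"
    and d: "\<And>x y. x \<in> {a..b} \<Longrightarrow> y \<in> {a..b} \<Longrightarrow> \<bar>x - y\<bar> < d \<Longrightarrow> \<bar>g x - g y\<bar> < e'"
    using \<open>e' > 0\<close> unfolding uniformly_continuous_on_def dist_real_def by (metis abs_minus_commute)
  obtain m :: nat where m: "(b - a) / d < m" using reals_Archimedean2 by blast
  define G where "G = (\<lambda>x. integral {a..x} g)"
  have G: "(G has_real_derivative g x) (at x within {a..b})" if "x \<in> {a..b}" for x
    using integral_has_real_derivative[OF g that] by (simp add: G_def)
  have "norm ((\<Sum>i<Suc n. (b - a) / Suc n * g (a + i * ((b - a) / Suc n))) - integral {a..b} g) < e"
    if "n \<ge> m" for n
  proof -
    define h where "h = (b - a) / Suc n"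
    define p where "p i = a + real i * h" for i
    have "h \<ge> 0" using assms(1) by (simp add: h_def)
    have nh: "Suc n * h = b - a" by (simp add: h_def)
    have "(b - a) / d < Suc n" using m that by (smt (verit) of_nat_mono le_SucI)
    then have "h < d" using \<open>d > 0\<close> by (simp add: h_def field_simps)
    have p_mem: "p i \<in> {a..b}" if "i \<le> Suc n" for i
    proof -
      have "real i * h \<le> Suc n * h" using that \<open>h \<ge> 0\<close> by (intro mult_right_mono) auto
      then show ?thesis using nh \<open>h \<ge> 0\<close> by (auto simp: p_def)
    qed
    have step: "\<bar>h * g (p i) - (G (p (Suc i)) - G (p i))\<bar> \<le> h * e'" if "i < Suc n" for i
    proof (cases "h = 0")
      case True
      then show ?thesis by (simp add: p_def)
    next
      case False
      have pp: "p (Suc i) = p i + h" by (simp add: p_def algebra_simps)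
      have lt: "p i < p (Suc i)" using False \<open>h \<ge> 0\<close> pp by simp
      have sub: "{p i..p (Suc i)} \<subseteq> {a..b}"
        using p_mem[of i] p_mem[of "Suc i"] that by auto
      have "\<exists>\<xi>\<in>{p i<..<p (Suc i)}. G (p (Suc i)) - G (p i) = g \<xi> * (p (Suc i) - p i)"
      proof (rule mvt_simple[OF lt])
        fix x assume "p i \<le> x" "x \<le> p (Suc i)"
        then have "(G has_field_derivative g x) (at x within {p i..p (Suc i)})"
          using sub by (intro DERIV_subset[OF G sub]) auto
        then show "(G has_derivative (\<lambda>h. g x * h)) (at x within {p i..p (Suc i)})"
          by (simp add: has_field_derivative_def)
      qed
      then obtain \<xi> where \<xi>: "p i < \<xi>" "\<xi> < p (Suc i)" "G (p (Suc i)) - G (p i) = h * g \<xi>"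
        using pp by auto
      have "\<bar>g (p i) - g \<xi>\<bar> < e'"
        using \<xi> sub pp \<open>h < d\<close> lt by (intro d) auto
      then have "h * \<bar>g (p i) - g \<xi>\<bar> \<le> h * e'" using \<open>h \<ge> 0\<close> by (simp add: mult_left_mono)
      then show ?thesis using \<xi>(3) \<open>h \<ge> 0\<close> by (simp add: abs_mult flip: right_diff_distrib)
    qed
    have "(\<Sum>i<Suc n. G (p (Suc i)) - G (p i)) = G (p (Suc n)) - G (p 0)"
      by (rule sum_lessThan_telescope)
    also have "\<dots> = integral {a..b} g" using nh by (simp add: p_def G_def)
    finally have "(\<Sum>i<Suc n. h * g (p i)) - integral {a..b} g =
        (\<Sum>i<Suc n. h * g (p i) - (G (p (Suc i)) - G (p i)))"
      by (simp only: sum_subtractf)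
    also have "\<bar>\<dots>\<bar> \<le> (\<Sum>i<Suc n. h * e')"
      by (rule order_trans[OF sum_abs sum_mono]) (use step in auto)
    also have "\<dots> = (Suc n * h) * e'" by simp
    also have "\<dots> = (b - a) * e'" by (simp only: nh)
    also have "\<dots> < e" using \<open>e > 0\<close> assms(1) by (simp add: e'_def field_simps)
    finally show ?thesis by (simp only: h_def p_def real_norm_def)
  qed
  then show "\<exists>m. \<forall>n\<ge>m. norm ((\<Sum>i<Suc n. (b - a) / Suc n * g (a + i * ((b - a) / Suc n)))
      - integral {a..b} g) < e"
    by blast
qed

text \<open>The Riemann sums are linear combinations of members, bounded by
  \<open>(b - a) * C\<close> uniformly in \<open>n\<close> and \<open>x\<close>, so the limit clause
  applies.\<close>

lemma bp_closure_integral: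
  fixes f :: "real \<Rightarrow> 'a \<Rightarrow> real"
  assumes "a \<le> b" "F \<noteq> {}" and f: "\<And>s. f s \<in> bp_closure F"
    and bound: "\<And>s x. s \<in> {a..b} \<Longrightarrow> \<bar>f s x\<bar> \<le> C" and cont: "\<And>x. continuous_on {a..b} (\<lambda>s. f s x)"
  shows "(\<lambda>x. integral {a..b} (\<lambda>s. f s x)) \<in> bp_closure F"
proof (rule bp_closure.limit[OF _ _ riemann_sums_tendsto[OF assms(1) cont]])
  fix n
  show "(\<lambda>x. \<Sum>i<Suc n. (b - a) / Suc n * f (a + i * ((b - a) / Suc n)) x) \<in> bp_closure F"
    using f assms(2) by (intro bp_closure_sum bp_closure.scale) auto
next
  fix n x
  have mem: "a + real i * ((b - a) / real (Suc n)) \<in> {a..b}" if "i < Suc n" for i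
  proof -
    have "real i * ((b - a) / real (Suc n)) \<le> Suc n * ((b - a) / real (Suc n))"
      using that assms(1) by (intro mult_right_mono) auto
    then show ?thesis using assms(1) by auto
  qed
  have "\<bar>\<Sum>i<Suc n. (b - a) / Suc n * f (a + i * ((b - a) / Suc n)) x\<bar>
      \<le> (\<Sum>i<Suc n. (b - a) / Suc n * C)"
  proof (rule order_trans[OF sum_abs sum_mono])
    fix i assume "i \<in> {..<Suc n}"
    then show "\<bar>(b - a) / real (Suc n) * f (a + real i * ((b - a) / real (Suc n))) x\<bar>
        \<le> (b - a) / real (Suc n) * C"
      using bound[OF mem, of i] assms(1) by (simp only: abs_mult) (intro mult_mono, auto)
  qed
  also have "\<dots> = (b - a) * C" by simp
  finally show "\<bar>\<Sum>i<Suc n. (b - a) / Suc n * f (a + i * ((b - a) / Suc n)) x\<bar> \<le> (b - a) * C" .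
qed

subsection \<open>Trigonometric functions generate everything\<close>

text \<open>Iterating this map drives \<open>[-1, 1]\<close> to the sign function.\<close>

definition sgn_iter :: "real \<Rightarrow> real" where
  "sgn_iter y = (3 * y - y ^ 3) / 2"

lemma sgn_iter_bounds:
  assumes "0 \<le> y" "y \<le> 1"
  shows "y \<le> sgn_iter y" "sgn_iter y \<le> 1"
proof -
  \<comment> \<open>This product is twice \<open>sgn_iter y - y\<close>; the one used for the upper
    bound is twice \<open>1 - sgn_iter y\<close>.\<close>
  have "0 \<le> y * (1 - y) * (1 + y)" using assms by (intro mult_nonneg_nonneg) auto
  then show "y \<le> sgn_iter y" by (simp add: sgn_iter_def field_simps power3_eq_cube)
  have "0 \<le> (1 - y) * (1 - y) * (2 + y)" using assms by (intro mult_nonneg_nonneg) auto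
  then show "sgn_iter y \<le> 1" by (simp add: sgn_iter_def field_simps power3_eq_cube)
qed

lemma sgn_iter_uminus: "sgn_iter (- y) = - sgn_iter y"
  by (simp add: sgn_iter_def field_simps)

lemma sgn_iter_funpow_uminus: "(sgn_iter ^^ n) (- y) = - (sgn_iter ^^ n) y"
  by (induction n) (auto simp: sgn_iter_uminus)

lemma sgn_iter_funpow_bounds:
  assumes "0 \<le> y" "y \<le> 1"
  shows "y \<le> (sgn_iter ^^ n) y \<and> (sgn_iter ^^ n) y \<le> 1"
  using assms
  by (induction n) (auto intro: order_trans[OF _ sgn_iter_bounds(1)] sgn_iter_bounds(2))

lemma sgn_iter_funpow_abs_le:
  assumes "\<bar>y\<bar> \<le> 1"
  shows "\<bar>(sgn_iter ^^ n) y\<bar> \<le> 1"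
proof (cases "y \<ge> 0")
  case True
  then show ?thesis using sgn_iter_funpow_bounds[of y n] assms by auto
next
  case False
  then show ?thesis
    using sgn_iter_funpow_bounds[of "- y" n] sgn_iter_funpow_uminus[of n y] assms by auto
qed

text \<open>The iterates increase and are bounded by 1, so they converge to a fixed point. The fixed
  points are -1, 0 and 1, and the lower bound \<open>y > 0\<close> leaves only 1.\<close>

lemma sgn_iter_funpow_tendsto_1:
  assumes "0 < y" "y \<le> 1"
  shows "(\<lambda>n. (sgn_iter ^^ n) y) \<longlonglongrightarrow> 1"
proof -
  let ?u = "\<lambda>n. (sgn_iter ^^ n) y"
  have b: "y \<le> ?u n \<and> ?u n \<le> 1" for n using sgn_iter_funpow_bounds[of y n] assms by simp
  have "?u n \<le> ?u (Suc n)" for n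
    using sgn_iter_bounds(1)[of "?u n"] b[of n] assms by simp
  then have "incseq ?u" by (rule incseq_SucI)
  then obtain L where L: "?u \<longlonglongrightarrow> L"
    by (rule incseq_convergent[of ?u 1]) (use b in auto)
  have "(\<lambda>n. sgn_iter (?u n)) \<longlonglongrightarrow> sgn_iter L"
    by (rule isCont_tendsto_compose[OF _ L]) (simp add: sgn_iter_def[abs_def])
  moreover have "(\<lambda>n. sgn_iter (?u n)) \<longlonglongrightarrow> L" using LIMSEQ_Suc[OF L] by simp
  ultimately have "sgn_iter L = L" by (rule LIMSEQ_unique)
  then have "L * (1 - L) * (1 + L) = 0" by (simp add: sgn_iter_def field_simps power3_eq_cube)
  moreover have "L \<ge> y" by (rule LIMSEQ_le_const[OF L]) (use b in auto)
  ultimately have "L = 1" using assms by auto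
  then show ?thesis using L by simp
qed

lemma sgn_iter_funpow_tendsto:
  assumes "\<bar>y\<bar> \<le> 1"
  shows "(\<lambda>n. (sgn_iter ^^ n) y) \<longlonglongrightarrow> sgn y"
proof (cases y "0::real" rule: linorder_cases)
  case equal
  have "(sgn_iter ^^ n) 0 = 0" for n by (induction n) (auto simp: sgn_iter_def)
  then show ?thesis using equal by simp
next
  case greater
  then show ?thesis using sgn_iter_funpow_tendsto_1[of y] assms by simp
next
  case less
  then show ?thesis
    using tendsto_minus[OF sgn_iter_funpow_tendsto_1[of "- y"]] assms
    by (simp add: sgn_iter_funpow_uminus)
qed

section \<open>The algebra and the sigma-algebra generated by cosines\<close>

definition cosines :: "('a \<Rightarrow> real) set \<Rightarrow> ('a \<Rightarrow> real) set" where
  "cosines H = {\<lambda>x. cos (h x + \<phi>) | h \<phi>. h \<in> H}"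

lemma cosinesI: "h \<in> H \<Longrightarrow> (\<lambda>x. cos (h x + \<phi>)) \<in> cosines H"
  by (auto simp: cosines_def)

lemma sin_mem_cosines: "h \<in> H \<Longrightarrow> (\<lambda>x. sin (h x + \<phi>)) \<in> cosines H"
  using cosinesI[of h H "\<phi> - pi / 2"] by (simp add: cos_diff cos_add sin_add algebra_simps)

lemma bp_closure_cosines_bounded:
  "f \<in> bp_closure (cosines H) \<Longrightarrow> \<exists>C. \<forall>x. \<bar>f x\<bar> \<le> C"
  by (erule bp_closure_bounded) (auto simp: cosines_def intro!: exI[of _ 1])

text \<open>Linearity is what the product formula needs: a product of cosines of \<open>h\<close>
  and \<open>h'\<close> is a combination of cosines of their difference and sum. The instances are
  the linear functions of one real variable and the linear functionals of the past.\<close>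

locale function_subspace =
  fixes H :: "('a \<Rightarrow> real) set"
  assumes zero_mem: "(\<lambda>x. 0) \<in> H"
    and add_mem: "h \<in> H \<Longrightarrow> h' \<in> H \<Longrightarrow> (\<lambda>x. h x + h' x) \<in> H"
    and scale_mem: "h \<in> H \<Longrightarrow> (\<lambda>x. c * h x) \<in> H"
begin

abbreviation trig :: "('a \<Rightarrow> real) set" where
  "trig \<equiv> bp_closure (cosines H)"

lemma const_mem_trig: "(\<lambda>x. c) \<in> trig"
  using bp_closure.scale[OF bp_closure.base[OF cosinesI[OF zero_mem, of 0]], of c] by simp

lemma cosines_mult:
  assumes "f \<in> cosines H" "g \<in> cosines H"
  shows "(\<lambda>x. f x * g x) \<in> trig"
proof -
  obtain h \<phi> h' \<psi> where fg: "f = (\<lambda>x. cos (h x + \<phi>))" "g = (\<lambda>x. cos (h' x + \<psi>))" "h \<in> H" "h' \<in> H"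
    using assms by (auto simp: cosines_def)
  have "(\<lambda>x. h x - h' x) \<in> H"
    using add_mem[OF fg(3) scale_mem[OF fg(4), of "-1"]] by simp
  then have "(\<lambda>x. 1 / 2 * cos ((h x - h' x) + (\<phi> - \<psi>)) + 1 / 2 * cos ((h x + h' x) + (\<phi> + \<psi>))) \<in> trig"
    using add_mem fg by (intro bp_closure.add bp_closure.scale bp_closure.base cosinesI) auto
  moreover have "f x * g x =
      1 / 2 * cos ((h x - h' x) + (\<phi> - \<psi>)) + 1 / 2 * cos ((h x + h' x) + (\<phi> + \<psi>))" for x
    by (simp add: fg cos_times_cos algebra_simps)
  ultimately show ?thesis by simp
qed

lemma mult_mem_trig_aux:
  assumes "f \<in> trig" "g \<in> cosines H"
  shows "(\<lambda>x. f x * g x) \<in> trig"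
  using assms(1)
proof induction
  case (add f f')
  then show ?case using bp_closure.add[OF add.IH] by (simp add: algebra_simps)
next
  case (scale f c)
  then show ?case using bp_closure.scale[OF scale.IH, of c] by (simp add: algebra_simps)
next
  case (limit f C h)
  have g: "\<bar>g x\<bar> \<le> 1" for x using assms(2) by (auto simp: cosines_def)
  have "\<bar>f n x * g x\<bar> \<le> C * 1" for n x
    unfolding abs_mult by (rule mult_mono') (use g limit.hyps(2) in auto)
  then show ?case
    by (intro bp_closure.limit[OF limit.IH]) (auto intro!: tendsto_intros limit.hyps(3))
qed (use cosines_mult assms in auto)

text \<open>The induction runs over one factor at a time: \<open>mult_mem_trig_aux\<close> settles
  the case of a cosine as second factor, which is the base case here. In the limit case the fixed
  factor has to be bounded, as all members of the closure are.\<close>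

lemma mult_mem_trig:
  assumes "f \<in> trig" "g \<in> trig"
  shows "(\<lambda>x. f x * g x) \<in> trig"
  using assms(2)
proof induction
  case (add g g')
  then show ?case using bp_closure.add[OF add.IH] by (simp add: algebra_simps)
next
  case (scale g c)
  then show ?case using bp_closure.scale[OF scale.IH, of c] by (simp add: algebra_simps)
next
  case (limit g C h)
  obtain K where K: "\<And>x. \<bar>f x\<bar> \<le> K" using bp_closure_cosines_bounded[OF assms(1)] by blast
  have "\<bar>f x * g n x\<bar> \<le> K * C" for n x
    unfolding abs_mult by (rule mult_mono') (use K limit.hyps(2) in auto)
  then show ?case
    by (intro bp_closure.limit[OF limit.IH]) (auto intro!: tendsto_intros limit.hyps(3))
qed (use mult_mem_trig_aux[OF assms(1)] in auto)

text \<open>After scaling into [-1, 1], every iterate of the cubic \<open>sgn_iter\<close> is a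
  polynomial in the function and stays in \<open>trig\<close>. The iterates are bounded by 1 and
  tend to the sign.\<close>

lemma sgn_mem_trig:
  assumes "f \<in> trig"
  shows "(\<lambda>x. sgn (f x)) \<in> trig"
proof -
  obtain C where C: "\<And>x. \<bar>f x\<bar> \<le> C" using bp_closure_cosines_bounded[OF assms] by blast
  define K where "K = \<bar>C\<bar> + 1"
  have "K > 0" by (simp add: K_def)
  let ?g = "\<lambda>x. 1 / K * f x"
  have g: "?g \<in> trig" by (intro bp_closure.scale assms)
  have g_le: "\<bar>?g x\<bar> \<le> 1" for x
    using C[of x] \<open>K > 0\<close> by (simp add: field_simps abs_mult K_def)
  have iter: "(\<lambda>x. (sgn_iter ^^ n) (?g x)) \<in> trig" for n
  proof (induction n)
    case (Suc n)
    let ?u = "\<lambda>x. (sgn_iter ^^ n) (?g x)"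
    have "(\<lambda>x. 3 / 2 * ?u x - 1 / 2 * (?u x * (?u x * ?u x))) \<in> trig"
      by (intro bp_closure_diff bp_closure.scale mult_mem_trig Suc)
    moreover have "(sgn_iter ^^ Suc n) (?g x) = 3 / 2 * ?u x - 1 / 2 * (?u x * (?u x * ?u x))" for x
      by (simp add: sgn_iter_def power3_eq_cube field_simps)
    ultimately show ?case by presburger
  qed (use g in simp)
  have "sgn (f x) = sgn (?g x)" for x using \<open>K > 0\<close> by (simp add: sgn_mult)
  moreover have "(\<lambda>x. sgn (?g x)) \<in> trig"
    by (rule bp_closure.limit[OF iter sgn_iter_funpow_abs_le[OF g_le] sgn_iter_funpow_tendsto[OF g_le]])
  ultimately show ?thesis by presburger
qed

lemma indicator_pos_mem_trig:
  assumes "f \<in> trig"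
  shows "(indicator {x. f x > 0} :: 'a \<Rightarrow> real) \<in> trig"
proof -
  have "(\<lambda>x. 1 / 2 * (sgn (f x) * sgn (f x) + sgn (f x))) \<in> trig"
    by (intro bp_closure.scale bp_closure.add mult_mem_trig sgn_mem_trig assms)
  moreover have "(indicator {x. f x > 0} :: 'a \<Rightarrow> real) =
      (\<lambda>x. 1 / 2 * (sgn (f x) * sgn (f x) + sgn (f x)))"
    by (auto simp: fun_eq_iff indicator_def sgn_real_def)
  ultimately show ?thesis by simp
qed

text \<open>For large \<open>n\<close> the sign of \<open>sin ((h x - c) / n)\<close> is that of \<open>h x - c\<close>.\<close>

lemma indicator_greater_mem_trig:
  assumes "h \<in> H"
  shows "(indicator {x. h x > c} :: 'a \<Rightarrow> real) \<in> trig"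
proof -
  let ?S = "\<lambda>n::nat. {x. sin ((h x - c) / Suc n) > 0}"
  have "(\<lambda>x. sin (1 / Suc n * h x + - c / Suc n)) \<in> trig" for n
    by (intro bp_closure.base sin_mem_cosines scale_mem assms)
  then have 1: "(indicator (?S n) :: 'a \<Rightarrow> real) \<in> trig" for n
    using indicator_pos_mem_trig[of "\<lambda>x. sin (1 / Suc n * h x + - c / Suc n)"]
    by (simp add: diff_divide_distrib)
  have lim: "(\<lambda>n. indicator (?S n) x :: real) \<longlonglongrightarrow> indicator {x. h x > c} x" for x
  proof (rule tendsto_eventually)
    \<comment> \<open>From this index on the argument of the sine lies strictly between
      \<open>- pi\<close> and \<open>pi\<close>, where the sine has the sign of its argument. At
      \<open>h x = c\<close> both strict inequalities fail.\<close>
    obtain m :: nat where m: "\<bar>h x - c\<bar> / pi < m" using reals_Archimedean2 by blast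
    have "indicator (?S n) x = (indicator {x. h x > c} x :: real)" if "n \<ge> m" for n
    proof -
      have "\<bar>h x - c\<bar> / pi < Suc n" using m that by (smt (verit) of_nat_mono le_SucI)
      then have lt: "\<bar>(h x - c) / Suc n\<bar> < pi" by (simp add: field_simps del: of_nat_Suc)
      show ?thesis
      proof (cases "h x > c")
        case True
        then have "sin ((h x - c) / Suc n) > 0"
          using lt by (intro sin_gt_zero) (auto simp del: of_nat_Suc)
        then show ?thesis using True by simp
      next
        case False
        then have "0 \<le> sin (- ((h x - c) / Suc n))"
          using lt by (intro sin_ge_zero) (auto simp del: of_nat_Suc simp: field_simps)
        then show ?thesis using False by simp
      qed
    qed
    then show "\<forall>\<^sub>F n in sequentially. indicator (?S n) x = (indicator {x. h x > c} x :: real)"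
      by (auto simp: eventually_sequentially)
  qed
  show ?thesis by (intro bp_closure.limit[OF 1 _ lim, where C = 1]) (simp add: indicator_def)
qed

text \<open>Complements come from the constant 1, finite intersections from products, countable
  intersections as bounded limits of finite ones, and unions by De Morgan.\<close>

lemma sigma_algebra_trig: "sigma_algebra UNIV {A. (indicator A :: 'a \<Rightarrow> real) \<in> trig}"
proof -
  have compl: "(indicator (- A) :: 'a \<Rightarrow> real) \<in> trig" if "(indicator A :: 'a \<Rightarrow> real) \<in> trig" for A
  proof -
    have "(indicator (- A) :: 'a \<Rightarrow> real) = (\<lambda>x. 1 - indicator A x)"
      by (auto simp: fun_eq_iff indicator_def)
    then show ?thesis using bp_closure_diff[OF const_mem_trig[of 1] that] by simp
  qed
  have inter: "(indicator (A \<inter> B) :: 'a \<Rightarrow> real) \<in> trig"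
    if "(indicator A :: 'a \<Rightarrow> real) \<in> trig" "(indicator B :: 'a \<Rightarrow> real) \<in> trig" for A B
  proof -
    have "(indicator (A \<inter> B) :: 'a \<Rightarrow> real) = (\<lambda>x. indicator A x * indicator B x)"
      by (auto simp: fun_eq_iff indicator_def)
    then show ?thesis using mult_mem_trig[OF that] by simp
  qed
  have Inter: "(indicator (\<Inter>i. A i) :: 'a \<Rightarrow> real) \<in> trig"
    if A: "\<And>i::nat. (indicator (A i) :: 'a \<Rightarrow> real) \<in> trig" for A
  proof -
    have fin: "(indicator (\<Inter>i\<le>n. A i) :: 'a \<Rightarrow> real) \<in> trig" for n
      by (induction n) (use A in \<open>auto simp: atMost_Suc intro: inter\<close>)
    have lim: "(\<lambda>n. indicator (\<Inter>i\<le>n. A i) x :: real) \<longlonglongrightarrow> indicator (\<Inter>i. A i) x" for x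
    proof (cases "x \<in> (\<Inter>i. A i)")
      case False
      then obtain m where "x \<notin> A m" by blast
      then show ?thesis
        by (intro tendsto_eventually eventually_sequentiallyI[of m]) (auto simp: indicator_def)
    qed (auto simp: indicator_def)
    show ?thesis by (intro bp_closure.limit[OF fin _ lim, where C = 1]) (simp add: indicator_def)
  qed
  have Union: "(indicator (\<Union>i. A i) :: 'a \<Rightarrow> real) \<in> trig"
    if "\<And>i::nat. (indicator (A i) :: 'a \<Rightarrow> real) \<in> trig" for A
    using compl[OF Inter[of "\<lambda>i. - A i"]] compl[OF that] by simp
  have "(indicator {} :: 'a \<Rightarrow> real) = (\<lambda>x. 0)" by (simp add: fun_eq_iff)
  then have "(indicator {} :: 'a \<Rightarrow> real) \<in> trig" using const_mem_trig[of 0] by simp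
  then show ?thesis
    unfolding sigma_algebra_iff2
    using compl Union by (auto simp: Compl_eq_Diff_UNIV image_subset_iff)
qed

text \<open>A simple function is a finite combination of indicators of its level sets. The map
  \<open>u\<close> is there because later only events pulled back along \<open>stop\<close> are
  known to have indicators in \<open>trig\<close>.\<close>

lemma simple_function_mem_trig:
  fixes s :: "'b \<Rightarrow> real"
  assumes "simple_function N s" "space N = UNIV"
    and "\<And>A. A \<in> sets N \<Longrightarrow> (indicator (u -` A) :: 'a \<Rightarrow> real) \<in> trig"
  shows "(\<lambda>x. s (u x)) \<in> trig"
proof -
  have fin: "finite (range s)" and m: "\<And>y. s -` {y} \<in> sets N"
    using simple_functionD[OF assms(1)] assms(2) by auto
  have "(\<lambda>x. \<Sum>y\<in>range s. y * indicator (u -` (s -` {y})) x) \<in> trig"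
    using zero_mem by (intro bp_closure_sum fin bp_closure.scale assms(3) m) (auto simp: cosines_def)
  moreover have "s (u x) = (\<Sum>y\<in>range s. y * indicator (u -` (s -` {y})) x)" for x
    using fin by (subst sum.remove[of _ "s (u x)"]) (auto intro!: sum.neutral simp: indicator_def)
  ultimately show ?thesis by presburger
qed

end

subsection \<open>Cosines from a bounded nonconstant activation function\<close>

lemma integrable_mult_bounded:
  fixes \<Psi> f :: "'a \<Rightarrow> real"
  assumes "integrable M \<Psi>" "f \<in> borel_measurable M" "\<And>x. \<bar>f x\<bar> \<le> C"
  shows "integrable M (\<lambda>x. \<Psi> x * f x)"
proof (rule Bochner_Integration.integrable_bound)
  show "integrable M (\<lambda>x. C * \<Psi> x)" using assms(1) by simp
  show "AE x in M. norm (\<Psi> x * f x) \<le> norm (C * \<Psi> x)"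
  proof (rule AE_I2)
    fix x
    have "\<bar>\<Psi> x\<bar> * \<bar>f x\<bar> \<le> \<bar>\<Psi> x\<bar> * \<bar>C\<bar>"
      using assms(3)[of x] by (intro mult_left_mono) auto
    then show "norm (\<Psi> x * f x) \<le> norm (C * \<Psi> x)" by (simp add: abs_mult mult.commute)
  qed
qed (use assms in auto)

text \<open>Orthogonality to \<open>\<Psi>\<close> is a linear condition, and it survives bounded
  limits by dominated convergence with majorant \<open>C * \<bar>\<Psi> x\<bar>\<close>.\<close>

lemma integral_mult_bp_closure_eq_0:
  fixes \<Psi> :: "'a \<Rightarrow> real"
  assumes "integrable M \<Psi>" and "f \<in> bp_closure F"
    and meas: "\<And>f. f \<in> F \<Longrightarrow> f \<in> borel_measurable M"
    and bdd: "\<And>f. f \<in> F \<Longrightarrow> \<exists>C. \<forall>x. \<bar>f x\<bar> \<le> C"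
    and zero: "\<And>f. f \<in> F \<Longrightarrow> (\<integral>x. \<Psi> x * f x \<partial>M) = 0"
  shows "(\<integral>x. \<Psi> x * f x \<partial>M) = 0"
proof -
  have int: "integrable M (\<lambda>x. \<Psi> x * f x)" if f: "f \<in> bp_closure F" for f
  proof -
    obtain C where "\<And>x. \<bar>f x\<bar> \<le> C" using bp_closure_bounded[OF f bdd] by blast
    then show ?thesis
      by (intro integrable_mult_bounded assms(1) bp_closure_measurable[OF f meas])
  qed
  show ?thesis
    using assms(2)
  proof induction
    case (add f g)
    then show ?case using int by (simp add: distrib_left)
  next
    case (scale f c)
    then show ?case by (simp add: mult.left_commute)
  next
    case (limit g C h)
    have "(\<lambda>n. \<integral>x. \<Psi> x * g n x \<partial>M) \<longlonglongrightarrow> (\<integral>x. \<Psi> x * h x \<partial>M)"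
    proof (rule integral_dominated_convergence)
      show "integrable M (\<lambda>x. C * \<bar>\<Psi> x\<bar>)" using assms(1) by simp
      show "AE x in M. (\<lambda>n. \<Psi> x * g n x) \<longlonglongrightarrow> \<Psi> x * h x"
        by (intro AE_I2 tendsto_intros limit.hyps(3))
      fix n
      show "AE x in M. norm (\<Psi> x * g n x) \<le> C * \<bar>\<Psi> x\<bar>"
        using limit.hyps(2)[of n]
        by (intro AE_I2) (simp add: abs_mult mult.commute[of C] mult_left_mono)
      show "(\<lambda>x. \<Psi> x * g n x) \<in> borel_measurable M"
        using int[OF limit.hyps(1)] by (rule borel_measurable_integrable)
      show "(\<lambda>x. \<Psi> x * h x) \<in> borel_measurable M"
        using int[OF bp_closure.limit[OF limit.hyps]] by (rule borel_measurable_integrable)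
    qed
    then have "(\<lambda>n. 0) \<longlonglongrightarrow> (\<integral>x. \<Psi> x * h x \<partial>M)" unfolding limit.IH .
    then show ?case by (simp add: LIMSEQ_const_iff)
  qed (use zero in auto)
qed

text \<open>If \<open>\<Psi> x\<close> were nonzero, \<open>\<Psi>\<close> would stay within
  \<open>\<bar>\<Psi> x\<bar> / 2\<close> of it on an interval of length \<open>2 * e\<close>. A
  vanishing integral there would force
  \<open>2 * e * \<bar>\<Psi> x\<bar> \<le> e * \<bar>\<Psi> x\<bar>\<close>.\<close>

lemma continuous_eq_0_if_intervals_0:
  fixes \<Psi> :: "real \<Rightarrow> real"
  assumes "integrable lborel \<Psi>" "continuous_on UNIV \<Psi>"
    and zero: "\<And>a b. a < b \<Longrightarrow> (\<integral>x. \<Psi> x * indicator {a<..b} x \<partial>lborel) = 0"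
  shows "\<Psi> x = 0"
proof (rule ccontr)
  assume nz: "\<Psi> x \<noteq> 0"
  have "isCont \<Psi> x" using assms(2) by (simp add: continuous_on_eq_continuous_at)
  then obtain d where "d > 0" and d: "\<And>y. \<bar>y - x\<bar> < d \<Longrightarrow> \<bar>\<Psi> y - \<Psi> x\<bar> < \<bar>\<Psi> x\<bar> / 2"
    using nz unfolding continuous_at_eps_delta dist_real_def
    by (metis half_gt_zero zero_less_abs_iff)
  define e where "e = d / 2"
  have "e > 0" using \<open>d > 0\<close> by (simp add: e_def)
  let ?I = "indicator {x - e<..x + e} :: real \<Rightarrow> real"
  have 1: "integrable lborel (\<lambda>y. \<Psi> y * ?I y)"
    by (rule integrable_mult_bounded[OF assms(1), of _ 1]) (auto simp: indicator_def)
  have 2: "integrable lborel ?I"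
    using \<open>e > 0\<close> by (intro integrable_real_indicator) auto
  have "\<bar>\<integral>y. (\<Psi> y * ?I y - \<Psi> x * ?I y) \<partial>lborel\<bar> \<le> (\<integral>y. \<bar>\<Psi> x\<bar> / 2 * ?I y \<partial>lborel)"
  proof (rule integral_abs_bound_integral)
    fix y
    show "\<bar>\<Psi> y * ?I y - \<Psi> x * ?I y\<bar> \<le> \<bar>\<Psi> x\<bar> / 2 * ?I y"
    proof (cases "y \<in> {x - e<..x + e}")
      case True
      then have "\<bar>y - x\<bar> < d" using \<open>d > 0\<close> by (simp add: e_def abs_less_iff)
      then show ?thesis using d[of y] True by simp
    qed simp
  qed (use 1 2 in auto)
  also have "(\<integral>y. (\<Psi> y * ?I y - \<Psi> x * ?I y) \<partial>lborel) = - (\<Psi> x * (2 * e))"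
    using 1 2 zero[of "x - e" "x + e"] \<open>e > 0\<close> by (simp add: measure_def)
  also have "(\<integral>y. \<bar>\<Psi> x\<bar> / 2 * ?I y \<partial>lborel) = \<bar>\<Psi> x\<bar> * e"
    using \<open>e > 0\<close> by (simp add: measure_def)
  finally show False using nz \<open>e > 0\<close> by (simp add: abs_mult)
qed

text \<open>If every nonzero frequency were absent from \<open>\<Psi>\<close>, then \<open>\<Psi>\<close> would be orthogonal to the
  bounded pointwise closure of the cosines, which contains the indicators of intervals.\<close>

lemma exists_nonzero_frequency:
  fixes \<Psi> :: "real \<Rightarrow> real"
  assumes "integrable lborel \<Psi>" "continuous_on UNIV \<Psi>" "\<Psi> x0 \<noteq> 0"
  obtains \<xi> where "\<xi> \<noteq> 0"
    "(\<integral>y. \<Psi> y * cos (\<xi> * y) \<partial>lborel) \<noteq> 0 \<or> (\<integral>y. \<Psi> y * sin (\<xi> * y) \<partial>lborel) \<noteq> 0"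
proof -
  have False if C: "\<And>\<xi>. \<xi> \<noteq> 0 \<Longrightarrow> (\<integral>y. \<Psi> y * cos (\<xi> * y) \<partial>lborel) = 0"
    and S: "\<And>\<xi>. \<xi> \<noteq> 0 \<Longrightarrow> (\<integral>y. \<Psi> y * sin (\<xi> * y) \<partial>lborel) = 0"
  proof -
    define H where "H = {\<lambda>x::real. a * x | a. True}"
    interpret function_subspace H
    proof
      show "(\<lambda>x. 0) \<in> H" unfolding H_def by (rule CollectI, rule exI[of _ 0]) (simp add: fun_eq_iff)
    next
      fix h h' assume "h \<in> H" "h' \<in> H"
      then obtain a b where "h = (\<lambda>x. a * x)" "h' = (\<lambda>x. b * x)" by (auto simp: H_def)
      then show "(\<lambda>x. h x + h' x) \<in> H"
        unfolding H_def by (intro CollectI exI[of _ "a + b"]) (auto simp: algebra_simps)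
    next
      fix h c assume "h \<in> H"
      then obtain a where "h = (\<lambda>x. a * x)" by (auto simp: H_def)
      then show "(\<lambda>x. c * h x) \<in> H"
        unfolding H_def by (intro CollectI exI[of _ "c * a"]) auto
    qed
    define F where "F = {\<lambda>x::real. cos (a * x + \<phi>) | a \<phi>. a \<noteq> 0}"
    have F: "(\<lambda>x. cos (a * x + \<phi>)) \<in> F" if "a \<noteq> 0" for a \<phi> using that by (auto simp: F_def)
    have "cosines H \<subseteq> bp_closure F"
    proof
      fix f assume "f \<in> cosines H"
      then obtain a \<phi> where f: "f = (\<lambda>x. cos (a * x + \<phi>))" by (auto simp: cosines_def H_def)
      \<comment> \<open>Orthogonality is assumed for nonzero frequencies; frequency 0 is reached as
        a bounded limit of the frequencies \<open>1 / Suc n\<close>.\<close>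
      have "(\<lambda>x. cos (0 * x + \<phi>)) \<in> bp_closure F"
      proof (rule bp_closure.limit[where C = 1])
        show "(\<lambda>x. cos (1 / Suc n * x + \<phi>)) \<in> bp_closure F" for n
          by (intro bp_closure.base F) simp
        show "(\<lambda>n. cos (1 / Suc n * x + \<phi>)) \<longlonglongrightarrow> cos (0 * x + \<phi>)" for x
          by (intro tendsto_intros LIMSEQ_Suc[OF lim_1_over_n])
      qed simp
      then show "f \<in> bp_closure F" by (cases "a = 0") (auto simp: f intro: bp_closure.base F)
    qed
    then have ortho: "(\<integral>x. \<Psi> x * f x \<partial>lborel) = 0" if "f \<in> trig" for f
    proof (intro integral_mult_bp_closure_eq_0[OF assms(1) bp_closure_trans[OF that]])
      fix f assume "f \<in> F"
      then obtain a \<phi> where f: "f = (\<lambda>x. cos (a * x + \<phi>))" "a \<noteq> 0" by (auto simp: F_def)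
      show "f \<in> borel_measurable lborel" unfolding f by measurable
      show "\<exists>C. \<forall>x. \<bar>f x\<bar> \<le> C" unfolding f by (intro exI[of _ 1]) simp
      have "integrable lborel (\<lambda>y. \<Psi> y * cos (a * y))" "integrable lborel (\<lambda>y. \<Psi> y * sin (a * y))"
        by (auto intro!: integrable_mult_bounded[OF assms(1), of _ 1])
      moreover have "\<Psi> x * f x = cos \<phi> * (\<Psi> x * cos (a * x)) - sin \<phi> * (\<Psi> x * sin (a * x))" for x
        by (simp add: f cos_add algebra_simps)
      ultimately show "(\<integral>x. \<Psi> x * f x \<partial>lborel) = 0" using C S f(2) by simp
    qed
    have id: "(\<lambda>x. x) \<in> H" unfolding H_def by (intro CollectI exI[of _ 1]) (simp add: fun_eq_iff)
    have "(\<integral>x. \<Psi> x * indicator {a<..b} x \<partial>lborel) = 0" if "a < b" for a b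
    proof -
      have "(indicator {a<..b} :: real \<Rightarrow> real) = (\<lambda>x. indicator {x. x > a} x - indicator {x. x > b} x)"
        using that by (auto simp: indicator_def fun_eq_iff)
      then have "(indicator {a<..b} :: real \<Rightarrow> real) \<in> trig"
        using bp_closure_diff[OF indicator_greater_mem_trig[OF id, of a] indicator_greater_mem_trig[OF id, of b]]
        by simp
      then show ?thesis by (rule ortho)
    qed
    then show False using continuous_eq_0_if_intervals_0[OF assms(1,2)] assms(3) by blast
  qed
  then show thesis using that by blast
qed

text \<open>Substituting \<open>y = x + b\<close> turns the integral into a mixture of translates of
  \<open>\<Psi>\<close> with weights \<open>cos (\<xi> * b + \<phi>)\<close>. Truncations to [-n, n]
  fall under \<open>bp_closure_integral\<close>, and the integral of
  \<open>\<bar>\<Psi>\<bar>\<close> bounds all of them.\<close>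

lemma integral_translate_mem_bp_closure:
  fixes \<Psi> :: "real \<Rightarrow> real"
  assumes "integrable lborel \<Psi>" "continuous_on UNIV \<Psi>" and bdd: "\<And>x. \<bar>\<Psi> x\<bar> \<le> K"
    and "F \<noteq> {}" and F: "\<And>b. (\<lambda>x. \<Psi> (x + b)) \<in> bp_closure F"
  shows "(\<lambda>x. \<integral>y. \<Psi> y * cos (\<xi> * (y - x) + \<phi>) \<partial>lborel) \<in> bp_closure F"
proof -
  define p where "p x b = \<Psi> (x + b) * cos (\<xi> * b + \<phi>)" for x b
  have cont: "continuous_on A (p x)" for x A
  proof -
    have "continuous_on A (\<lambda>b. \<Psi> (x + b))"
      by (rule continuous_on_compose2[OF assms(2)]) (auto intro!: continuous_intros)
    then show ?thesis unfolding p_def by (intro continuous_intros)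
  qed
  have shift: "integrable lborel (\<lambda>b. \<Psi> (x + b))" for x
    using lborel_integrable_real_affine[OF assms(1), of 1 x] by simp
  have int: "integrable lborel (p x)" for x
    unfolding p_def by (rule integrable_mult_bounded[OF shift, of _ 1]) auto
  have eq: "(\<integral>b. p x b \<partial>lborel) = (\<integral>y. \<Psi> y * cos (\<xi> * (y - x) + \<phi>) \<partial>lborel)" for x
    unfolding p_def
    by (subst lborel_integral_real_affine[of 1 "\<lambda>y. \<Psi> y * cos (\<xi> * (y - x) + \<phi>)" x]) auto
  have L: "integral {- real n..real n} (p x) = (\<integral>b. indicator {- real n..real n} b * p x b \<partial>lborel)" for n x
    using set_borel_integral_eq_integral(2)[of "{- real n..real n}" "p x"]
      borel_integrable_atLeastAtMost'[OF cont]
    by (simp add: set_lebesgue_integral_def)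
  have le: "norm (indicator {- real n..real n} b * p x b) \<le> \<bar>\<Psi> (x + b)\<bar>" for n x b
    by (auto simp: p_def indicator_def abs_mult mult_left_le)
  have meas: "(\<lambda>b. indicator {- real n..real n} b * p x b) \<in> borel_measurable lborel" for n x
    using int[of x] by (auto dest: borel_measurable_integrable)
  have "(\<lambda>x. \<integral>b. p x b \<partial>lborel) \<in> bp_closure F"
  proof (rule bp_closure.limit)
    fix n
    show "(\<lambda>x. integral {- real n..real n} (p x)) \<in> bp_closure F"
    proof (rule bp_closure_integral)
      show "(\<lambda>x. p x s) \<in> bp_closure F" for s
        unfolding p_def by (intro bp_closure_mult_right F)
      show "\<bar>p x s\<bar> \<le> K" for x s
      proof -
        have "\<bar>p x s\<bar> \<le> \<bar>\<Psi> (x + s)\<bar>" by (auto simp: p_def abs_mult mult_left_le)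
        then show ?thesis using bdd[of "x + s"] by linarith
      qed
    qed (use assms(4) cont in auto)
    fix x
    have "\<bar>integral {- real n..real n} (p x)\<bar> \<le> (\<integral>b. \<bar>\<Psi> (x + b)\<bar> \<partial>lborel)"
      unfolding L
    proof (rule integral_abs_bound_integral)
      show "integrable lborel (\<lambda>b. indicator {- real n..real n} b * p x b)"
        by (rule Bochner_Integration.integrable_bound[OF shift[of x] meas]) (use le in auto)
    qed (use shift le in auto)
    also have "\<dots> = (\<integral>y. \<bar>\<Psi> y\<bar> \<partial>lborel)"
      by (subst lborel_integral_real_affine[of 1 _ x]) auto
    finally show "\<bar>integral {- real n..real n} (p x)\<bar> \<le> (\<integral>y. \<bar>\<Psi> y\<bar> \<partial>lborel)" .
  next
    fix x
    show "(\<lambda>n. integral {- real n..real n} (p x)) \<longlonglongrightarrow> (\<integral>b. p x b \<partial>lborel)"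
      unfolding L
    proof (rule integral_dominated_convergence)
      show "integrable lborel (\<lambda>b. \<bar>\<Psi> (x + b)\<bar>)" using shift by simp
      show "AE b in lborel. (\<lambda>n. indicator {- real n..real n} b * p x b) \<longlonglongrightarrow> p x b"
      proof (rule AE_I2)
        fix b :: real
        obtain m :: nat where "\<bar>b\<bar> < real m" using reals_Archimedean2 by blast
        have "indicator {- real n..real n} b * p x b = p x b" if "n \<ge> m" for n
        proof -
          have "real m \<le> real n" using that by simp
          then have "b \<in> {- real n..real n}" using \<open>\<bar>b\<bar> < real m\<close> unfolding atLeastAtMost_iff by linarith
          then show ?thesis by simp
        qed
        then have "\<forall>\<^sub>F n in sequentially. indicator {- real n..real n} b * p x b = p x b"
          by (rule eventually_sequentiallyI)
        then show "(\<lambda>n. indicator {- real n..real n} b * p x b) \<longlonglongrightarrow> p x b"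
          by (rule tendsto_eventually)
      qed
    qed (use meas le int in \<open>auto dest: borel_measurable_integrable\<close>)
  qed
  then show ?thesis unfolding eq .
qed

text \<open>Expanding the cosine, the mixture of translates becomes
  \<open>C * cos (\<phi> - \<xi> * x) - S * sin (\<phi> - \<xi> * x)\<close>, where \<open>C\<close>
  and \<open>S\<close> are the cosine and sine transforms of \<open>\<Psi>\<close> at
  \<open>\<xi>\<close>. The phases \<open>- \<phi>\<close> and \<open>pi / 2 - \<phi>\<close> give a
  linear system for the cosine and sine of \<open>\<xi> * x + \<phi>\<close>, solvable because
  \<open>R = C\<^sup>2 + S\<^sup>2\<close> is nonzero.\<close>

lemma cos_mem_bp_closure_of_integrable:
  fixes \<Psi> :: "real \<Rightarrow> real"
  assumes "integrable lborel \<Psi>" "continuous_on UNIV \<Psi>" and bdd: "\<And>x. \<bar>\<Psi> x\<bar> \<le> K" and "\<Psi> x0 \<noteq> 0"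
    and "F \<noteq> {}" and F: "\<And>b. (\<lambda>x. \<Psi> (x + b)) \<in> bp_closure F"
  obtains \<xi> where "\<xi> \<noteq> 0" "\<And>\<phi>. (\<lambda>x. cos (\<xi> * x + \<phi>)) \<in> bp_closure F"
proof -
  obtain \<xi> where "\<xi> \<noteq> 0" and CS:
    "(\<integral>y. \<Psi> y * cos (\<xi> * y) \<partial>lborel) \<noteq> 0 \<or> (\<integral>y. \<Psi> y * sin (\<xi> * y) \<partial>lborel) \<noteq> 0"
    using exists_nonzero_frequency[OF assms(1,2,4)] by blast
  define C where "C = (\<integral>y. \<Psi> y * cos (\<xi> * y) \<partial>lborel)"
  define S where "S = (\<integral>y. \<Psi> y * sin (\<xi> * y) \<partial>lborel)"
  define R where "R = C\<^sup>2 + S\<^sup>2"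
  have "R \<noteq> 0" using CS by (auto simp: R_def C_def S_def add_nonneg_eq_0_iff)
  have int: "integrable lborel (\<lambda>y. \<Psi> y * cos (\<xi> * y))" "integrable lborel (\<lambda>y. \<Psi> y * sin (\<xi> * y))"
    by (auto intro!: integrable_mult_bounded[OF assms(1), of _ 1])
  have I: "(\<integral>y. \<Psi> y * cos (\<xi> * (y - x) + \<phi>) \<partial>lborel) = C * cos (\<phi> - \<xi> * x) - S * sin (\<phi> - \<xi> * x)" for x \<phi>
  proof -
    have "\<Psi> y * cos (\<xi> * (y - x) + \<phi>) =
        \<Psi> y * cos (\<xi> * y) * cos (\<phi> - \<xi> * x) - \<Psi> y * sin (\<xi> * y) * sin (\<phi> - \<xi> * x)" for y
    proof -
      have "\<xi> * (y - x) + \<phi> = \<xi> * y + (\<phi> - \<xi> * x)" by (simp add: algebra_simps)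
      then show ?thesis by (simp only: cos_add) (simp add: algebra_simps)
    qed
    then show ?thesis using int by (simp add: C_def S_def)
  qed
  have mem: "(\<lambda>x. C * cos (\<phi> - \<xi> * x) - S * sin (\<phi> - \<xi> * x)) \<in> bp_closure F" for \<phi>
    using integral_translate_mem_bp_closure[OF assms(1-3,5) F, of \<xi> \<phi>] by (simp only: I)
  have "(\<lambda>x. cos (\<xi> * x + \<phi>)) \<in> bp_closure F" for \<phi>
  proof -
    let ?\<theta> = "\<lambda>x. \<xi> * x + \<phi>"
    have "(\<lambda>x. C / R * (C * cos (- \<phi> - \<xi> * x) - S * sin (- \<phi> - \<xi> * x))
        - S / R * (C * cos ((pi / 2 - \<phi>) - \<xi> * x) - S * sin ((pi / 2 - \<phi>) - \<xi> * x))) \<in> bp_closure F"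
      by (intro bp_closure_diff bp_closure.scale mem)
    moreover have "C / R * (C * cos (- \<phi> - \<xi> * x) - S * sin (- \<phi> - \<xi> * x))
        - S / R * (C * cos ((pi / 2 - \<phi>) - \<xi> * x) - S * sin ((pi / 2 - \<phi>) - \<xi> * x)) = cos (?\<theta> x)" for x
    proof -
      have 1: "- \<phi> - \<xi> * x = - ?\<theta> x" "(pi / 2 - \<phi>) - \<xi> * x = pi / 2 - ?\<theta> x" by auto
      have "C / R * (C * cos (- ?\<theta> x) - S * sin (- ?\<theta> x))
          - S / R * (C * cos (pi / 2 - ?\<theta> x) - S * sin (pi / 2 - ?\<theta> x))
          = C / R * (C * cos (?\<theta> x) + S * sin (?\<theta> x)) - S / R * (C * sin (?\<theta> x) - S * cos (?\<theta> x))"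
        by (simp only: cos_minus sin_minus cos_diff sin_diff cos_pi_half sin_pi_half) simp
      also have "\<dots> = (C * (C * cos (?\<theta> x) + S * sin (?\<theta> x)) - S * (C * sin (?\<theta> x) - S * cos (?\<theta> x))) / R"
        by (simp add: diff_divide_distrib)
      also have "C * (C * cos (?\<theta> x) + S * sin (?\<theta> x)) - S * (C * sin (?\<theta> x) - S * cos (?\<theta> x))
          = R * cos (?\<theta> x)"
        by (simp add: R_def power2_eq_square algebra_simps)
      finally show ?thesis unfolding 1 using \<open>R \<noteq> 0\<close> by simp
    qed
    ultimately show ?thesis by (simp only:)
  qed
  with \<open>\<xi> \<noteq> 0\<close> show thesis by (rule that)
qed

text \<open>If all second differences vanished, \<open>\<sigma>\<close> would be affine along every
  arithmetic progression, and boundedness would force each slope \<open>d\<close> to be 0.\<close>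

lemma bounded_nonconstant_second_difference:
  fixes \<sigma> :: "real \<Rightarrow> real"
  assumes bdd: "\<And>x. \<bar>\<sigma> x\<bar> \<le> C" and "\<not> \<sigma> constant_on UNIV"
  obtains b h where "h > 0" "\<sigma> (b + 2 * h) - 2 * \<sigma> (b + h) + \<sigma> b \<noteq> 0"
proof -
  have False if zero: "\<And>b h. h > 0 \<Longrightarrow> \<sigma> (b + 2 * h) - 2 * \<sigma> (b + h) + \<sigma> b = 0"
  proof -
    have eq: "\<sigma> (b + h) = \<sigma> b" if "h > 0" for b h
    proof (rule ccontr)
      assume ne: "\<sigma> (b + h) \<noteq> \<sigma> b"
      define d where "d = \<sigma> (b + h) - \<sigma> b"
      have lin: "\<sigma> (b + real n * h) = \<sigma> b + n * d \<and> \<sigma> (b + real (Suc n) * h) = \<sigma> b + Suc n * d" for n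
      proof (induction n)
        case 0
        show ?case by (simp add: d_def)
      next
        case (Suc n)
        have "\<sigma> ((b + n * h) + 2 * h) = 2 * \<sigma> ((b + n * h) + h) - \<sigma> (b + n * h)"
          using zero[OF that, of "b + n * h"] by simp
        moreover have "(b + n * h) + 2 * h = b + Suc (Suc n) * h" "(b + n * h) + h = b + Suc n * h"
          by (auto simp: algebra_simps)
        ultimately have "\<sigma> (b + Suc (Suc n) * h) = 2 * \<sigma> (b + Suc n * h) - \<sigma> (b + n * h)"
          by simp
        then show ?case using Suc by (auto simp: algebra_simps)
      qed
      obtain n :: nat where n: "2 * C / \<bar>d\<bar> < n" using reals_Archimedean2 by blast
      have "n * \<bar>d\<bar> = \<bar>\<sigma> (b + n * h) - \<sigma> b\<bar>" using lin[of n] by (simp add: abs_mult)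
      also have "\<dots> \<le> 2 * C" using bdd[of "b + n * h"] bdd[of b] by linarith
      finally show False using n ne by (simp add: d_def field_simps)
    qed
    have "\<sigma> x = \<sigma> y" for x y
      using eq[of "y - x" x] eq[of "x - y" y] by (cases x y rule: linorder_cases) auto
    then have "\<sigma> constant_on UNIV" unfolding constant_on_def by blast
    then show False using assms(2) by blast
  qed
  then show thesis using that by blast
qed

text \<open>The second difference of \<open>\<sigma>\<close> is the second derivative of the second difference \<open>q\<close> of a
  second antiderivative of \<open>\<sigma>\<close>, and \<open>q\<close> is bounded by the mean value theorem.\<close>

lemma second_difference_antiderivative:
  fixes \<sigma> :: "real \<Rightarrow> real"
  assumes cont: "continuous_on UNIV \<sigma>" and bdd: "\<And>x. \<bar>\<sigma> x\<bar> \<le> C" and "h > 0"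
  obtains q q' where
    "\<And>x. (q has_real_derivative q' x) (at x)"
    "\<And>x. (q' has_real_derivative \<sigma> (x + 2 * h) - 2 * \<sigma> (x + h) + \<sigma> x) (at x)"
    "\<And>x. \<bar>q x\<bar> \<le> h\<^sup>2 * C"
proof -
  have anti: "\<exists>F. \<forall>x. (F has_real_derivative f x) (at x)" if "continuous_on UNIV f" for f :: "real \<Rightarrow> real"
    using einterval_antiderivative[of "-\<infinity>" \<infinity> f] that
    by (auto simp: has_real_derivative_iff_has_vector_derivative continuous_on_eq_continuous_at)
  obtain S where S: "\<And>x. (S has_real_derivative \<sigma> x) (at x)" using anti[OF cont] by blast
  have "continuous_on UNIV S"
    using S by (meson DERIV_isCont continuous_at_imp_continuous_on)
  then obtain SS where SS: "\<And>x. (SS has_real_derivative S x) (at x)" using anti by blast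
  have S_at: "((\<lambda>x. S (x + a)) has_real_derivative \<sigma> (x + a)) (at x)" for a x
    using DERIV_shift S by blast
  have SS_at: "((\<lambda>x. SS (x + a)) has_real_derivative S (x + a)) (at x)" for a x
    using DERIV_shift SS by blast
  define q where "q x = SS (x + 2 * h) - 2 * SS (x + h) + SS x" for x
  define q' where "q' x = S (x + 2 * h) - 2 * S (x + h) + S x" for x
  show thesis
  proof (rule that)
    show "(q has_real_derivative q' x) (at x)" for x
      unfolding q_def[abs_def] q'_def by (intro derivative_intros SS_at SS DERIV_cmult)
    show "(q' has_real_derivative \<sigma> (x + 2 * h) - 2 * \<sigma> (x + h) + \<sigma> x) (at x)" for x
      unfolding q'_def[abs_def] by (intro derivative_intros S_at S DERIV_cmult)
    fix x
    define p where "p = (\<lambda>x. SS (x + h) - SS x)"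
    have p: "(p has_real_derivative S (y + h) - S y) (at y)" for y
      unfolding p_def by (intro derivative_intros SS_at SS)
    \<comment> \<open>The second difference \<open>q\<close> is a first difference of
      \<open>p\<close>, so two uses of the mean value theorem reach a value of
      \<open>\<sigma>\<close>.\<close>
    obtain y where y: "p (x + h) - p x = h * (S (y + h) - S y)"
      using MVT2[of x "x + h" p "\<lambda>y. S (y + h) - S y"] p \<open>h > 0\<close> by auto
    obtain z where z: "S (y + h) - S y = h * \<sigma> z"
      using MVT2[of y "y + h" S \<sigma>] S \<open>h > 0\<close> by auto
    have "q x = p (x + h) - p x" by (simp add: q_def p_def algebra_simps)
    then have "q x = h\<^sup>2 * \<sigma> z" using y z by (simp add: power2_eq_square)
    then show "\<bar>q x\<bar> \<le> h\<^sup>2 * C" using bdd[of z] by (simp add: abs_mult mult_left_mono)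
  qed
qed

text \<open>The double zeros at 1 and 2 remove all boundary terms when integrating by parts twice
  over [1, 2].\<close>

definition bump :: "real \<Rightarrow> real" where
  "bump s = (s - 1)\<^sup>2 * (2 - s)\<^sup>2"

lemma bump_nonneg: "0 \<le> bump s"
  by (simp add: bump_def)

lemma bump_le_1: "s \<in> {1..2} \<Longrightarrow> bump s \<le> 1"
  unfolding bump_def by (intro mult_le_one power_le_one) auto

lemma continuous_on_bump: "continuous_on A bump"
  unfolding bump_def by (intro continuous_intros)

text \<open>At the origin dilation has no effect, so averaging multiplies the value there by this
  integral; being nonzero, it keeps the averaged function from vanishing at 0.\<close>

lemma integral_bump: "integral {1..2} bump = 1 / 30"
proof -
  let ?B = "\<lambda>s::real. s ^ 5 / 5 - 3 * s ^ 4 / 2 + 13 * s ^ 3 / 3 - 6 * s\<^sup>2 + 4 * s"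
  have "(bump has_integral ?B 2 - ?B 1) {1..2}"
  proof (rule fundamental_theorem_of_calculus)
    fix s :: real
    have "(?B has_real_derivative bump s) (at s within {1..2})"
      unfolding bump_def
      by (auto intro!: derivative_eq_intros simp: power2_eq_square algebra_simps eval_nat_numeral)
    then show "(?B has_vector_derivative bump s) (at s within {1..2})"
      by (simp add: has_real_derivative_iff_has_vector_derivative)
  qed simp
  then show ?thesis by (simp add: integral_unique)
qed

text \<open>Averaging over dilations gives decay: integrating by parts twice in \<open>s\<close> moves the
  derivatives from \<open>q (s x)\<close> to the bump function and gains a factor \<open>1 / x\<^sup>2\<close>.\<close>

lemma dilation_average_decay:
  fixes q q' D :: "real \<Rightarrow> real"
  assumes q: "\<And>x. (q has_real_derivative q' x) (at x)" "\<And>x. (q' has_real_derivative D x) (at x)"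
    and D: "continuous_on UNIV D" and bdd: "\<And>x. \<bar>q x\<bar> \<le> Q"
  shows "x\<^sup>2 * \<bar>integral {1..2} (\<lambda>s. D (s * x) * bump s)\<bar> \<le> 2 * Q"
proof -
  define k' where "k' s = 2 * (s - 1) * (2 - s) * (3 - 2 * s)" for s :: real
  define k'' where "k'' s = 12 * s\<^sup>2 - 36 * s + 26" for s :: real
  have k: "(bump has_real_derivative k' s) (at s)" "(k' has_real_derivative k'' s) (at s)" for s
    unfolding bump_def[abs_def] k'_def[abs_def] k''_def
    by (auto intro!: derivative_eq_intros simp: power2_eq_square algebra_simps)
  \<comment> \<open>On [1, 2] the product \<open>(s - 1) * (s - 2)\<close> lies between -1/4 and 0,
    so \<open>k''\<close> lies between -1 and 2.\<close>
  have k''_le: "\<bar>k'' s\<bar> \<le> 2" if "s \<in> {1..2}" for s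
  proof -
    have "(s - 1) * (s - 2) \<le> 0" using that by (intro mult_nonneg_nonpos) auto
    moreover have "k'' s = 12 * ((s - 1) * (s - 2)) + 2" by (simp add: k''_def power2_eq_square algebra_simps)
    moreover have "(s - 1) * (s - 2) = (s - 3 / 2)\<^sup>2 - 1 / 4" by (simp add: power2_eq_square algebra_simps)
    moreover have "(s - 3 / 2)\<^sup>2 \<ge> 0" by simp
    ultimately show ?thesis by linarith
  qed
  have qs: "((\<lambda>s. q (s * x)) has_real_derivative q' (s * x) * x) (at s)"
       "((\<lambda>s. q' (s * x)) has_real_derivative D (s * x) * x) (at s)" for s
    by (rule DERIV_chain2[OF q(1)], auto intro!: derivative_eq_intros)
       (rule DERIV_chain2[OF q(2)], auto intro!: derivative_eq_intros)
  \<comment> \<open>Both integrations by parts are done at once: the derivative of \<open>?W\<close>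
    is the difference of the two integrands to be compared. Nothing is divided by \<open>x\<close>,
    so \<open>x = 0\<close> is no special case.\<close>
  let ?W = "\<lambda>s. x * (q' (s * x) * bump s) - q (s * x) * k' s"
  have cont: "continuous_on {1..2} (\<lambda>s. D (s * x) * bump s)"
    by (intro continuous_intros continuous_on_bump continuous_on_compose2[OF D]) auto
  have cont_q: "continuous_on {1..2} (\<lambda>s. q (s * x) * k'' s)"
  proof (intro continuous_intros)
    show "continuous_on {1..2} (\<lambda>s. q (s * x))"
      using qs(1) by (intro continuous_at_imp_continuous_on ballI DERIV_isCont) blast
  qed (unfold k''_def, intro continuous_intros)
  have "((\<lambda>s. x\<^sup>2 * (D (s * x) * bump s) - q (s * x) * k'' s) has_integral ?W 2 - ?W 1) {1..2}"
  proof (rule fundamental_theorem_of_calculus)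
    fix s :: real
    have "(?W has_real_derivative x * (D (s * x) * x * bump s + k' s * q' (s * x))
        - (q' (s * x) * x * k' s + k'' s * q (s * x))) (at s)"
      by (intro DERIV_diff DERIV_cmult DERIV_mult qs k)
    also have "x * (D (s * x) * x * bump s + k' s * q' (s * x)) - (q' (s * x) * x * k' s + k'' s * q (s * x))
        = x\<^sup>2 * (D (s * x) * bump s) - q (s * x) * k'' s"
      by (simp add: power2_eq_square algebra_simps)
    finally have "(?W has_real_derivative x\<^sup>2 * (D (s * x) * bump s) - q (s * x) * k'' s) (at s within {1..2})"
      by (rule has_field_derivative_at_within)
    then show "(?W has_vector_derivative x\<^sup>2 * (D (s * x) * bump s) - q (s * x) * k'' s) (at s within {1..2})"
      by (simp add: has_real_derivative_iff_has_vector_derivative)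
  qed simp
  moreover have "?W 2 - ?W 1 = 0" by (simp add: bump_def k'_def)
  ultimately have "integral {1..2} (\<lambda>s. x\<^sup>2 * (D (s * x) * bump s) - q (s * x) * k'' s) = 0"
    by (simp add: integral_unique)
  then have "x\<^sup>2 * integral {1..2} (\<lambda>s. D (s * x) * bump s) = integral {1..2} (\<lambda>s. q (s * x) * k'' s)"
    using cont cont_q
    by (subst (asm) integral_diff) (auto intro!: integrable_continuous_interval continuous_intros)
  moreover have "\<bar>integral {1..2} (\<lambda>s. q (s * x) * k'' s)\<bar> \<le> 2 * Q"
  proof -
    have "norm (integral {1..2} (\<lambda>s. q (s * x) * k'' s)) \<le> (2 * Q) * (2 - 1)"
    proof (rule integral_bound[OF _ cont_q])
      fix s :: real assume "s \<in> {1..2}"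
      then have "\<bar>q (s * x)\<bar> * \<bar>k'' s\<bar> \<le> Q * 2"
        using bdd[of "s * x"] k''_le[of s] by (intro mult_mono) auto
      then show "norm (q (s * x) * k'' s) \<le> 2 * Q" by (simp add: abs_mult)
    qed simp
    then show ?thesis by simp
  qed
  ultimately show ?thesis by (metis abs_mult abs_power2)
qed

lemma integrable_of_inverse_square_decay:
  fixes \<Psi> :: "real \<Rightarrow> real"
  assumes "continuous_on UNIV \<Psi>" "\<And>x. \<bar>\<Psi> x\<bar> \<le> K" "\<And>x. x\<^sup>2 * \<bar>\<Psi> x\<bar> \<le> L"
  shows "integrable lborel \<Psi>"
proof (rule Bochner_Integration.integrable_bound)
  have UNIV: "einterval (- \<infinity>) \<infinity> = (UNIV :: real set)" by (auto simp: einterval_iff)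
  show "integrable lborel (\<lambda>x::real. (K + L) * inverse (1 + x\<^sup>2))"
    using integrable_inverse_1_plus_square by (simp add: UNIV set_integrable_def)
  show "\<Psi> \<in> borel_measurable lborel"
    using assms(1) by (simp add: borel_measurable_continuous_onI)
  show "AE x in lborel. norm (\<Psi> x) \<le> norm ((K + L) * inverse (1 + x\<^sup>2))"
  proof (rule AE_I2)
    fix x :: real
    have pos: "1 + x\<^sup>2 > 0" by (simp add: add_pos_nonneg)
    have "\<bar>\<Psi> x\<bar> * (1 + x\<^sup>2) \<le> K + L" using assms(2,3)[of x] by (simp add: algebra_simps)
    then have "\<bar>\<Psi> x\<bar> \<le> (K + L) * inverse (1 + x\<^sup>2)" using pos by (simp add: field_simps)
    then show "norm (\<Psi> x) \<le> norm ((K + L) * inverse (1 + x\<^sup>2))"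
      unfolding real_norm_def by (rule order_trans[OF _ abs_ge_self])
  qed
qed

definition dilates :: "(real \<Rightarrow> real) \<Rightarrow> (real \<Rightarrow> real) set" where
  "dilates \<sigma> = {\<lambda>x. \<sigma> (l * x + b) | l b. True}"

lemma dilatesI: "(\<lambda>x. \<sigma> (l * x + b)) \<in> dilates \<sigma>"
  by (auto simp: dilates_def)

lemma bp_closure_dilates_affine:
  assumes "f \<in> bp_closure (dilates \<sigma>)"
  shows "(\<lambda>x. f (l * x + b)) \<in> bp_closure (dilates \<sigma>)"
proof (rule bp_closure_compose[OF assms])
  fix f assume "f \<in> dilates \<sigma>"
  then obtain m c where f: "f = (\<lambda>x. \<sigma> (m * x + c))" by (auto simp: dilates_def)
  have "(\<lambda>x. f (l * x + b)) = (\<lambda>x. \<sigma> ((m * l) * x + (m * b + c)))" by (simp add: f algebra_simps)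
  then show "(\<lambda>x. f (l * x + b)) \<in> bp_closure (dilates \<sigma>)"
    using dilatesI by (simp only: bp_closure.base)
qed

text \<open>The averaged second difference \<open>\<Psi>\<close> is continuous, bounded, integrable
  and nonzero at 0, and its translates lie in the closure, so cosines of one nonzero frequency are
  available. Rescaling the variable gives every other frequency.\<close>

lemma cos_mem_bp_closure_dilates:
  fixes \<sigma> :: "real \<Rightarrow> real"
  assumes cont: "continuous_on UNIV \<sigma>" and "bounded (range \<sigma>)" and nonconst: "\<not> \<sigma> constant_on UNIV"
  shows "(\<lambda>x. cos (a * x + \<phi>)) \<in> bp_closure (dilates \<sigma>)"
proof -
  obtain C where C: "\<And>x. \<bar>\<sigma> x\<bar> \<le> C" using assms(2) by (auto simp: bounded_iff)
  obtain b h where "h > 0" and nz: "\<sigma> (b + 2 * h) - 2 * \<sigma> (b + h) + \<sigma> b \<noteq> 0"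
    using bounded_nonconstant_second_difference[OF C nonconst] by blast
  obtain q0 q0' where q0: "\<And>x. (q0 has_real_derivative q0' x) (at x)"
    "\<And>x. (q0' has_real_derivative \<sigma> (x + 2 * h) - 2 * \<sigma> (x + h) + \<sigma> x) (at x)"
    "\<And>x. \<bar>q0 x\<bar> \<le> h\<^sup>2 * C"
    using second_difference_antiderivative[OF cont C \<open>h > 0\<close>] by blast
  \<comment> \<open>The shift by \<open>b\<close> moves the nonzero second difference to the origin,
    the point fixed by all dilations.\<close>
  define D where "D y = \<sigma> (y + (b + 2 * h)) - 2 * \<sigma> (y + (b + h)) + \<sigma> (y + b)" for y
  have q: "((\<lambda>y. q0 (y + b)) has_real_derivative q0' (y + b)) (at y)"
    "((\<lambda>y. q0' (y + b)) has_real_derivative D y) (at y)" for y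
    using q0(1)[of "y + b"] q0(2)[of "y + b"] by (simp_all add: DERIV_shift D_def add.assoc)
  have D_cont: "continuous_on A D" for A
    unfolding D_def by (intro continuous_intros continuous_on_compose2[OF cont]) auto
  have D_le: "\<bar>D y\<bar> \<le> 4 * C" for y
    unfolding D_def using C[of "y + (b + 2 * h)"] C[of "y + (b + h)"] C[of "y + b"] by linarith
  have "C \<ge> 0" using C[of 0] by linarith
  define \<Psi> where "\<Psi> x = integral {1..2} (\<lambda>s. D (s * x) * bump s)" for x
  have \<Psi>_cont: "continuous_on UNIV \<Psi>"
    unfolding \<Psi>_def cbox_interval[symmetric]
    by (intro integral_continuous_on_param)
       (auto simp: case_prod_unfold intro!: continuous_intros continuous_on_compose2[OF D_cont[of UNIV]]
         continuous_on_compose2[OF continuous_on_bump[of UNIV]])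
  have le: "\<bar>D y * bump s\<bar> \<le> 4 * C" if "s \<in> {1..2}" for s y
  proof -
    have "\<bar>D y\<bar> * \<bar>bump s\<bar> \<le> 4 * C * 1"
      using D_le[of y] bump_le_1[OF that] bump_nonneg[of s] \<open>C \<ge> 0\<close> by (intro mult_mono) auto
    then show ?thesis by (simp add: abs_mult)
  qed
  have cont_s: "continuous_on {1..2} (\<lambda>s. D (s * x) * bump s)" for x
    by (intro continuous_intros continuous_on_bump continuous_on_compose2[OF D_cont[of UNIV]]) auto
  have \<Psi>_le: "\<bar>\<Psi> x\<bar> \<le> 4 * C" for x
    using integral_bound[OF _ cont_s[of x], of "4 * C"] le by (simp add: \<Psi>_def)
  have \<Psi>_int: "integrable lborel \<Psi>"
    using \<Psi>_cont \<Psi>_le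
    by (rule integrable_of_inverse_square_decay)
       (unfold \<Psi>_def, rule dilation_average_decay[OF q D_cont], rule q0(3))
  have "\<Psi> 0 \<noteq> 0" using nz by (simp add: \<Psi>_def integral_bump D_def add.commute)
  have ne: "dilates \<sigma> \<noteq> {}" using dilatesI by blast
  have \<Psi>_mem: "(\<lambda>x. \<Psi> (x + c)) \<in> bp_closure (dilates \<sigma>)" for c
    unfolding \<Psi>_def
  proof (rule bp_closure_integral[OF _ ne])
    fix s
    have "(\<lambda>x. \<sigma> (s * x + (s * c + (b + 2 * h))) - 2 * \<sigma> (s * x + (s * c + (b + h))) + \<sigma> (s * x + (s * c + b)))
        \<in> bp_closure (dilates \<sigma>)"
      by (intro bp_closure.add bp_closure_diff bp_closure.scale bp_closure.base dilatesI)
    then have "(\<lambda>x. D (s * (x + c))) \<in> bp_closure (dilates \<sigma>)"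
      by (simp add: D_def algebra_simps)
    then show "(\<lambda>x. D (s * (x + c)) * bump s) \<in> bp_closure (dilates \<sigma>)"
      by (rule bp_closure_mult_right)
  qed (use le cont_s in auto)
  obtain \<xi> where "\<xi> \<noteq> 0" and \<xi>: "\<And>\<phi>. (\<lambda>x. cos (\<xi> * x + \<phi>)) \<in> bp_closure (dilates \<sigma>)"
    using cos_mem_bp_closure_of_integrable[OF \<Psi>_int \<Psi>_cont \<Psi>_le \<open>\<Psi> 0 \<noteq> 0\<close> ne \<Psi>_mem] by blast
  show ?thesis
    using bp_closure_dilates_affine[OF \<xi>[of \<phi>], of "a / \<xi>" 0] \<open>\<xi> \<noteq> 0\<close> by simp
qed

subsection \<open>Echo state networks with strictly lower triangular connectivity\<close>

text \<open>The state of neuron \<open>i\<close> at time \<open>0\<close> as a functional of the input sequence, when only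
  connections from neurons \<open>j < i\<close> are used.\<close>

fun neuron :: "(real \<Rightarrow> real) \<Rightarrow> (nat \<Rightarrow> nat \<Rightarrow> real) \<Rightarrow> (nat \<Rightarrow> 'd::finite \<Rightarrow> real) \<Rightarrow> (nat \<Rightarrow> real) \<Rightarrow>
    nat \<Rightarrow> (int \<Rightarrow> real ^ 'd) \<Rightarrow> real" where
  "neuron \<sigma> A Win \<zeta> i z =
     \<sigma> ((\<Sum>j<i. A i j * neuron \<sigma> A Win \<zeta> j (time_shift (-1) z)) + (\<Sum>k\<in>UNIV. Win i k * z 0 $ k) + \<zeta> i)"

declare neuron.simps [simp del]

text \<open>Masking an arbitrary matrix avoids carrying a triangularity condition through the
  constructions of networks.\<close>

definition lower :: "(nat \<Rightarrow> nat \<Rightarrow> real) \<Rightarrow> nat \<Rightarrow> nat \<Rightarrow> real" where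
  "lower A i j = (if j < i then A i j else 0)"

lemma sum_lower:
  assumes "i < N"
  shows "(\<Sum>j<N. lower A i j * f j) = (\<Sum>j<i. A i j * f j)"
proof -
  have "(\<Sum>j<N. lower A i j * f j) = (\<Sum>j<i. lower A i j * f j)"
    using assms by (intro sum.mono_neutral_right) (auto simp: lower_def)
  also have "\<dots> = (\<Sum>j<i. A i j * f j)" by (intro sum.cong) (auto simp: lower_def)
  finally show ?thesis .
qed

lemma time_shift_time_shift: "time_shift s (time_shift t z) = time_shift (s + t) z"
  by (simp add: time_shift_def fun_eq_iff ac_simps)

lemma time_shift_apply: "time_shift s z t = z (t + s)"
  by (simp add: time_shift_def)

definition neuron_states where
  "neuron_states \<sigma> N A Win \<zeta> z t = restrict (\<lambda>i. neuron \<sigma> A Win \<zeta> i (time_shift t z)) {..<N}"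

text \<open>Neuron \<open>i\<close> only sees neurons \<open>j < i\<close> one time step earlier, so
  the state equation is solved by recursion on the neuron index instead of on time. This gives
  existence and uniqueness of the states together, and no contraction argument enters.\<close>

lemma esn_states_lower_iff:
  "esn_states \<sigma> N (lower A) Win \<zeta> z r \<longleftrightarrow> r = neuron_states \<sigma> N A Win \<zeta> z"
proof
  assume r: "esn_states \<sigma> N (lower A) Win \<zeta> z r"
  have "r t i = neuron \<sigma> A Win \<zeta> i (time_shift t z)" if "i < N" for i t
    using that
  proof (induction i arbitrary: t rule: less_induct)
    case (less i)
    have "r t i = \<sigma> ((\<Sum>j<i. A i j * r (t - 1) j) + (\<Sum>k\<in>UNIV. Win i k * z t $ k) + \<zeta> i)"
      using r less.prems by (simp add: esn_states_def sum_lower)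
    also have "(\<Sum>j<i. A i j * r (t - 1) j) =
        (\<Sum>j<i. A i j * neuron \<sigma> A Win \<zeta> j (time_shift (-1) (time_shift t z)))"
      using less by (intro sum.cong) (auto simp: time_shift_time_shift)
    finally show ?case by (subst neuron.simps) (simp add: time_shift_apply)
  qed
  moreover have "r t \<in> extensional {..<N}" for t using r by (simp add: esn_states_def)
  ultimately show "r = neuron_states \<sigma> N A Win \<zeta> z"
    by (intro ext) (auto simp: neuron_states_def restrict_def extensional_def)
next
  assume r: "r = neuron_states \<sigma> N A Win \<zeta> z"
  have "r t i = \<sigma> ((\<Sum>j<i. A i j * r (t - 1) j) + (\<Sum>k\<in>UNIV. Win i k * z t $ k) + \<zeta> i)"
    if "i < N" for i t
  proof -
    have "(\<Sum>j<i. A i j * r (t - 1) j) =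
        (\<Sum>j<i. A i j * neuron \<sigma> A Win \<zeta> j (time_shift (-1) (time_shift t z)))"
      using that by (intro sum.cong) (auto simp: time_shift_time_shift r neuron_states_def)
    moreover have "r t i = neuron \<sigma> A Win \<zeta> i (time_shift t z)" using that by (simp add: r neuron_states_def)
    ultimately show ?thesis by (subst (asm) neuron.simps) (simp add: time_shift_apply)
  qed
  then show "esn_states \<sigma> N (lower A) Win \<zeta> z r"
    by (simp add: esn_states_def sum_lower) (simp add: r neuron_states_def)
qed

lemma echo_state_property_lower: "echo_state_property \<sigma> N (lower A) Win \<zeta>"
  by (simp add: echo_state_property_def esn_states_lower_iff)

lemma esn_filter_lower:
  "esn_filter \<sigma> N (lower A) Win \<zeta> w z t = (\<chi> k. \<Sum>i<N. w i k * neuron \<sigma> A Win \<zeta> i (time_shift t z))"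
  by (simp add: esn_filter_def esn_states_lower_iff neuron_states_def vec_eq_iff)

section \<open>Measurability, causality and time invariance of the network filters\<close>

abbreviation paths :: "(int \<Rightarrow> real ^ 'd::finite) measure" where
  "paths \<equiv> Pi\<^sub>M UNIV (\<lambda>_. borel)"

lemma space_paths: "space paths = UNIV"
  by (simp add: space_PiM)

lemma measurable_pathsI:
  assumes "\<And>i. (\<lambda>\<omega>. f \<omega> i) \<in> borel_measurable N"
  shows "f \<in> N \<rightarrow>\<^sub>M paths"
  using measurable_PiM_single'[of UNIV "\<lambda>i \<omega>. f \<omega> i" N "\<lambda>_. borel"] assms
  by (auto simp: PiE_iff)

lemma borel_measurable_vec_iff:
  fixes f :: "'a \<Rightarrow> real ^ 'd::finite"
  shows "f \<in> borel_measurable N \<longleftrightarrow> (\<forall>k. (\<lambda>x. f x $ k) \<in> borel_measurable N)"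
  unfolding borel_measurable_euclidean_space[of f] by (auto simp: Basis_vec_def inner_axis)

lemma measurable_path_component [measurable]: "(\<lambda>z. z t) \<in> borel_measurable paths"
  by (rule measurable_component_singleton) simp

lemma measurable_path_coordinate [measurable]: "(\<lambda>z. z t $ k) \<in> borel_measurable paths"
  by (rule borel_measurable_vec_iff[THEN iffD1, rule_format, OF measurable_path_component])

lemma measurable_time_shift [measurable]: "time_shift s \<in> paths \<rightarrow>\<^sub>M paths"
  by (rule measurable_pathsI) (simp add: time_shift_apply)

lemma measurable_neuron:
  assumes "\<sigma> \<in> borel_measurable borel"
  shows "neuron \<sigma> A Win \<zeta> i \<in> borel_measurable paths"
proof (induction i rule: less_induct)
  case (less i)
  have "(\<lambda>z. \<sigma> ((\<Sum>j<i. A i j * neuron \<sigma> A Win \<zeta> j (time_shift (-1) z)) + (\<Sum>k\<in>UNIV. Win i k * z 0 $ k) + \<zeta> i))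
      \<in> borel_measurable paths"
    by (intro measurable_compose[OF _ assms] borel_measurable_add borel_measurable_sum borel_measurable_times
        borel_measurable_const measurable_path_coordinate measurable_compose[OF measurable_time_shift less]) auto
  moreover have "neuron \<sigma> A Win \<zeta> i = (\<lambda>z. \<sigma> ((\<Sum>j<i. A i j * neuron \<sigma> A Win \<zeta> j (time_shift (-1) z)) +
      (\<Sum>k\<in>UNIV. Win i k * z 0 $ k) + \<zeta> i))"
    by (rule ext) (rule neuron.simps)
  ultimately show ?case by simp
qed

lemma neuron_causal:
  assumes "\<And>k. k \<le> 0 \<Longrightarrow> z k = z' k"
  shows "neuron \<sigma> A Win \<zeta> i z = neuron \<sigma> A Win \<zeta> i z'"
  using assms
proof (induction i arbitrary: z z' rule: less_induct)
  case (less i)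
  have "neuron \<sigma> A Win \<zeta> j (time_shift (-1) z) = neuron \<sigma> A Win \<zeta> j (time_shift (-1) z')" if "j < i" for j
    using that by (rule less.IH) (simp add: time_shift_apply less.prems)
  then show ?case using less.prems[of 0] by (simp add: neuron.simps[of _ _ _ _ i])
qed

lemma seq_filter_esn_lower:
  assumes "\<sigma> \<in> borel_measurable borel"
  shows "seq_filter (esn_filter \<sigma> N (lower A) Win \<zeta> w)"
  unfolding seq_filter_def
proof (rule measurable_pathsI)
  fix t
  show "(\<lambda>z. esn_filter \<sigma> N (lower A) Win \<zeta> w z t) \<in> borel_measurable paths"
    unfolding borel_measurable_vec_iff esn_filter_lower vec_lambda_beta
    by (intro allI borel_measurable_sum borel_measurable_times borel_measurable_const
        measurable_compose[OF measurable_time_shift measurable_neuron[OF assms]])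
qed

lemma causal_esn_lower:
  fixes Win :: "nat \<Rightarrow> 'd::finite \<Rightarrow> real"
  shows "causal (esn_filter \<sigma> N (lower A) Win \<zeta> w)"
  unfolding causal_def
proof (intro allI impI)
  fix z z' :: "int \<Rightarrow> real ^ 'd" and t assume "\<forall>s\<le>t. z s = z' s"
  then have "neuron \<sigma> A Win \<zeta> i (time_shift t z) = neuron \<sigma> A Win \<zeta> i (time_shift t z')" for i
    by (intro neuron_causal) (simp add: time_shift_apply)
  then show "esn_filter \<sigma> N (lower A) Win \<zeta> w z t = esn_filter \<sigma> N (lower A) Win \<zeta> w z' t"
    by (simp add: esn_filter_lower)
qed

lemma time_invariant_esn_lower: "time_invariant (esn_filter \<sigma> N (lower A) Win \<zeta> w)"
  by (auto simp: time_invariant_def fun_eq_iff time_shift_apply esn_filter_lower time_shift_time_shift)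

lemma neuron_cong:
  assumes "\<And>j. j \<le> i \<Longrightarrow> A j = A' j \<and> Win j = Win' j \<and> \<zeta> j = \<zeta>' j"
  shows "neuron \<sigma> A Win \<zeta> i z = neuron \<sigma> A' Win' \<zeta>' i z"
  using assms
proof (induction i arbitrary: z rule: less_induct)
  case (less i)
  have "neuron \<sigma> A Win \<zeta> j z = neuron \<sigma> A' Win' \<zeta>' j z" if "j < i" for j z
    using that by (rule less.IH) (use that less.prems in auto)
  then show ?case using less.prems[of i] by (simp add: neuron.simps[of _ _ _ _ i])
qed

section \<open>Combining and extending networks\<close>

definition join :: "nat \<Rightarrow> (nat \<Rightarrow> 'c) \<Rightarrow> (nat \<Rightarrow> 'c) \<Rightarrow> nat \<Rightarrow> 'c" where
  "join n f g i = (if i < n then f i else g (i - n))"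

lemma join_simps [simp]: "i < n \<Longrightarrow> join n f g i = f i" "join n f g (n + i) = g i"
  by (auto simp: join_def)

lemma sum_lessThan_add: "(\<Sum>j<n + i. f j) = (\<Sum>j<n. f j) + (\<Sum>j<i. f (n + j))" for n i :: nat
  by (induction i) (auto simp: ac_simps)

text \<open>The rows of the second block have weight 0 on the first \<open>n\<close> neurons, so the
  two networks run side by side without interaction.\<close>

lemma neuron_join_right:
  "neuron \<sigma> (join n A (\<lambda>i. join n (\<lambda>_. 0) (B i))) (join n Win Win') (join n \<zeta> \<zeta>') (n + i) z =
    neuron \<sigma> B Win' \<zeta>' i z"
proof (induction i arbitrary: z rule: less_induct)
  case (less i)
  then show ?case
    by (simp add: neuron.simps[of _ _ _ _ "n + i"] neuron.simps[of _ _ _ _ i] sum_lessThan_add)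
qed

definition readouts :: "(real \<Rightarrow> real) \<Rightarrow> ((int \<Rightarrow> real ^ 'd::finite) \<Rightarrow> real) set" where
  "readouts \<sigma> = {\<lambda>z. \<Sum>i<N. w i * neuron \<sigma> A Win \<zeta> i z | N A Win \<zeta> w. 0 < N}"

lemma readoutsI:
  assumes "0 < N" "\<And>z. f z = (\<Sum>i<N. w i * neuron \<sigma> A Win \<zeta> i z)"
  shows "f \<in> readouts \<sigma>"
proof -
  have "f = (\<lambda>z. \<Sum>i<N. w i * neuron \<sigma> A Win \<zeta> i z)" using assms(2) by (rule ext)
  with assms(1) show ?thesis
    unfolding readouts_def by (intro CollectI exI[of _ N] exI[of _ A] exI[of _ Win] exI[of _ \<zeta>] exI[of _ w]) simp
qed

text \<open>The components of a vector-valued output must share one reservoir, so the separate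
  networks are placed side by side.\<close>

lemma readouts_common_network:
  assumes "finite K" "\<And>k. k \<in> K \<Longrightarrow> \<rho> k \<in> readouts \<sigma>"
  shows "\<exists>N A Win \<zeta> w. 0 < N \<and> (\<forall>k\<in>K. \<rho> k = (\<lambda>z. \<Sum>i<N. w i k * neuron \<sigma> A Win \<zeta> i z))"
  using assms
proof (induction K rule: finite_induct)
  case empty
  then show ?case by (intro exI[of _ 1]) auto
next
  case (insert k0 K)
  obtain N A Win \<zeta> w where N: "0 < N" and
    w: "\<And>k. k \<in> K \<Longrightarrow> \<rho> k = (\<lambda>z. \<Sum>i<N. w i k * neuron \<sigma> A Win \<zeta> i z)"
    using insert.IH insert.prems by auto
  obtain N' B Win' \<zeta>' w' where w': "\<rho> k0 = (\<lambda>z. \<Sum>i<N'. w' i * neuron \<sigma> B Win' \<zeta>' i z)"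
    using insert.prems[of k0] by (auto simp: readouts_def)
  let ?n = "neuron \<sigma> (join N A (\<lambda>i. join N (\<lambda>_. 0) (B i))) (join N Win Win') (join N \<zeta> \<zeta>')"
  have left: "?n i z = neuron \<sigma> A Win \<zeta> i z" if "i < N" for i z
    using that by (intro neuron_cong) auto
  \<comment> \<open>Each output puts weight 0 on the block that does not belong to it.\<close>
  define v where "v = join N (\<lambda>i k. if k = k0 then 0 else w i k) (\<lambda>i k. if k = k0 then w' i else 0)"
  have "\<rho> k = (\<lambda>z. \<Sum>i<N + N'. v i k * ?n i z)" if "k \<in> insert k0 K" for k
    using that insert.hyps(2) w w'
    by (cases "k = k0") (auto simp: sum_lessThan_add v_def neuron_join_right left)
  then show ?case using N by (intro exI[of _ "N + N'"] exI conjI) auto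
qed

lemma readouts_add:
  assumes "\<rho> \<in> readouts \<sigma>" "\<rho>' \<in> readouts \<sigma>"
  shows "(\<lambda>z. \<rho> z + \<rho>' z) \<in> readouts \<sigma>"
proof -
  \<comment> \<open>The two summands are indexed by the booleans so that the common network lemma
    applies.\<close>
  have mem: "(if k then \<rho> else \<rho>') \<in> readouts \<sigma>" for k using assms by simp
  obtain N A Win \<zeta> w where N: "0 < N"
    and w: "\<And>k. (if k then \<rho> else \<rho>') = (\<lambda>z. \<Sum>i<N. w i k * neuron \<sigma> A Win \<zeta> i z)"
    using readouts_common_network[of UNIV "\<lambda>k. if k then \<rho> else \<rho>'" \<sigma>, OF finite mem]
    unfolding ball_UNIV by blast
  show ?thesis
    by (rule readoutsI[OF N, of _ "\<lambda>i. w i True + w i False"])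
       (use w[of True] w[of False] in \<open>simp add: distrib_right sum.distrib\<close>)
qed

lemma readouts_scale:
  assumes "\<rho> \<in> readouts \<sigma>"
  shows "(\<lambda>z. c * \<rho> z) \<in> readouts \<sigma>"
proof -
  obtain N A Win \<zeta> w where "0 < N" "\<rho> = (\<lambda>z. \<Sum>i<N. w i * neuron \<sigma> A Win \<zeta> i z)"
    using assms by (auto simp: readouts_def)
  then show ?thesis
    by (intro readoutsI[of N _ "\<lambda>i. c * w i"]) (auto simp: sum_distrib_left mult.assoc)
qed

text \<open>A new last neuron \<open>N\<close> takes the readout weights, scaled by
  \<open>c\<close>, as its incoming weights. Since neurons see earlier states only, the old readout
  enters with a delay of one step while the input enters undelayed.\<close>

lemma readouts_append:
  assumes "\<rho> \<in> readouts \<sigma>"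
  shows "(\<lambda>z. \<sigma> (c * (\<rho> (time_shift (-1) z) + (\<Sum>k\<in>UNIV. W k * z 0 $ k)) + b)) \<in> readouts \<sigma>"
proof -
  obtain N A Win \<zeta> w where N: "0 < N" and \<rho>: "\<rho> = (\<lambda>z. \<Sum>i<N. w i * neuron \<sigma> A Win \<zeta> i z)"
    using assms by (auto simp: readouts_def)
  let ?A = "A(N := \<lambda>j. c * w j)" and ?W = "Win(N := \<lambda>k. c * W k)" and ?\<zeta> = "\<zeta>(N := b)"
  let ?v = "\<lambda>i. if i = N then 1 else 0"
  have left: "neuron \<sigma> ?A ?W ?\<zeta> i z = neuron \<sigma> A Win \<zeta> i z" if "i < N" for i z
    using that by (intro neuron_cong) auto
  have "(\<Sum>i<Suc N. ?v i * neuron \<sigma> ?A ?W ?\<zeta> i z) =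
      \<sigma> (c * (\<rho> (time_shift (-1) z) + (\<Sum>k\<in>UNIV. W k * z 0 $ k)) + b)" for z
    by (simp add: neuron.simps[of _ _ _ _ N] left \<rho> sum_distrib_left distrib_left mult.assoc)
  then show ?thesis by (intro readoutsI[of "Suc N" _ ?v \<sigma> ?A ?W ?\<zeta>]) auto
qed

lemma readouts_measurable:
  "\<sigma> \<in> borel_measurable borel \<Longrightarrow> \<rho> \<in> readouts \<sigma> \<Longrightarrow> \<rho> \<in> borel_measurable paths"
  by (auto simp: readouts_def intro!: borel_measurable_sum borel_measurable_times measurable_neuron)

lemma readouts_bounded:
  assumes "bounded (range \<sigma>)" "\<rho> \<in> readouts \<sigma>"
  shows "\<exists>C. \<forall>z. \<bar>\<rho> z\<bar> \<le> C"
proof -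
  obtain C where C: "\<And>x. \<bar>\<sigma> x\<bar> \<le> C" using assms(1) by (auto simp: bounded_iff)
  obtain N A Win \<zeta> w where \<rho>: "\<rho> = (\<lambda>z. \<Sum>i<N. w i * neuron \<sigma> A Win \<zeta> i z)"
    using assms(2) by (auto simp: readouts_def)
  have "\<bar>neuron \<sigma> A Win \<zeta> i z\<bar> \<le> C" for i z by (subst neuron.simps) (rule C)
  then have "\<bar>\<rho> z\<bar> \<le> (\<Sum>i<N. \<bar>w i\<bar> * C)" for z
    unfolding \<rho> by (intro order_trans[OF sum_abs sum_mono]) (simp add: abs_mult mult_left_mono)
  then show ?thesis by blast
qed

subsection \<open>Mean square approximation by readouts\<close>

text \<open>Squared errors are tracked throughout, with this bound in place of the triangle
  inequality; its factors 2 explain the tolerances \<open>\<epsilon> / 4\<close>.\<close>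

lemma integral_square_add_le:
  fixes u v :: "'a \<Rightarrow> real"
  assumes "integrable M (\<lambda>x. (u x)\<^sup>2)" "integrable M (\<lambda>x. (v x)\<^sup>2)"
  shows "(\<integral>x. (u x + v x)\<^sup>2 \<partial>M) \<le> 2 * (\<integral>x. (u x)\<^sup>2 \<partial>M) + 2 * (\<integral>x. (v x)\<^sup>2 \<partial>M)"
proof -
  have "(\<integral>x. (u x + v x)\<^sup>2 \<partial>M) \<le> (\<integral>x. 2 * (u x)\<^sup>2 + 2 * (v x)\<^sup>2 \<partial>M)"
  proof (rule integral_mono')
    fix x
    have "0 \<le> (u x - v x)\<^sup>2" by simp
    then show "(u x + v x)\<^sup>2 \<le> 2 * (u x)\<^sup>2 + 2 * (v x)\<^sup>2"
      by (simp add: power2_eq_square algebra_simps)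
  qed (use assms in auto)
  then show ?thesis using assms by simp
qed

definition bounded_measurable :: "((int \<Rightarrow> real ^ 'd::finite) \<Rightarrow> real) \<Rightarrow> bool" where
  "bounded_measurable G \<longleftrightarrow> G \<in> borel_measurable paths \<and> (\<exists>C. \<forall>z. \<bar>G z\<bar> \<le> C)"

lemma bounded_measurableI:
  "G \<in> borel_measurable paths \<Longrightarrow> (\<And>z. \<bar>G z\<bar> \<le> C) \<Longrightarrow> bounded_measurable G"
  by (auto simp: bounded_measurable_def)

lemma bounded_measurable_add:
  assumes "bounded_measurable F" "bounded_measurable G"
  shows "bounded_measurable (\<lambda>z. F z + G z)"
proof -
  obtain C D where "\<And>z. \<bar>F z\<bar> \<le> C" "\<And>z. \<bar>G z\<bar> \<le> D"
    using assms by (auto simp: bounded_measurable_def)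
  then have "\<bar>F z + G z\<bar> \<le> C + D" for z by (meson abs_triangle_ineq add_mono order_trans)
  then show ?thesis using assms by (intro bounded_measurableI) (auto simp: bounded_measurable_def)
qed

lemma bounded_measurable_scale:
  assumes "bounded_measurable F"
  shows "bounded_measurable (\<lambda>z. c * F z)"
proof -
  obtain C where "\<And>z. \<bar>F z\<bar> \<le> C" using assms by (auto simp: bounded_measurable_def)
  then have "\<bar>c * F z\<bar> \<le> \<bar>c\<bar> * C" for z by (simp add: abs_mult mult_left_mono)
  then show ?thesis using assms by (intro bounded_measurableI) (auto simp: bounded_measurable_def)
qed

lemma bounded_measurable_diff:
  assumes "bounded_measurable F" "bounded_measurable G"
  shows "bounded_measurable (\<lambda>z. F z - G z)"
  using bounded_measurable_add[OF assms(1) bounded_measurable_scale[OF assms(2), of "-1"]] by simp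

definition path_laws :: "(int \<Rightarrow> real ^ 'd::finite) measure set set" where
  "path_laws = {P. finite P \<and> (\<forall>\<mu>\<in>P. prob_space \<mu> \<and> sets \<mu> = sets paths)}"

lemma path_lawsD:
  assumes "P \<in> path_laws" "\<mu> \<in> P"
  shows "prob_space \<mu>" "sets \<mu> = sets paths"
  using assms by (auto simp: path_laws_def)

lemma bounded_measurable_integrable_square:
  assumes "P \<in> path_laws" "\<mu> \<in> P" "bounded_measurable G"
  shows "integrable \<mu> (\<lambda>z. (G z)\<^sup>2)"
proof -
  interpret prob_space \<mu> by (rule path_lawsD(1)[OF assms(1,2)])
  obtain C where C: "\<And>z. \<bar>G z\<bar> \<le> C" using assms(3) by (auto simp: bounded_measurable_def)
  have [measurable]: "G \<in> borel_measurable \<mu>"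
    using assms(3) path_lawsD(2)[OF assms(1,2)]
    by (simp add: bounded_measurable_def cong: measurable_cong_sets)
  have "(G z)\<^sup>2 \<le> C\<^sup>2" for z using C[of z] power_mono[of "\<bar>G z\<bar>" C 2] by simp
  then show ?thesis by (intro integrable_const_bound[of _ "C\<^sup>2"]) auto
qed

text \<open>The readout is chosen after the set \<open>P\<close> of laws but before the law in it,
  so it is common to all laws of \<open>P\<close>.\<close>

definition approximable :: "(real \<Rightarrow> real) \<Rightarrow> ((int \<Rightarrow> real ^ 'd::finite) \<Rightarrow> real) set" where
  "approximable \<sigma> = {G. bounded_measurable G \<and>
     (\<forall>P\<in>path_laws. \<forall>\<epsilon>>0. \<exists>\<rho>\<in>readouts \<sigma>. \<forall>\<mu>\<in>P. (\<integral>z. (G z - \<rho> z)\<^sup>2 \<partial>\<mu>) < \<epsilon>)}"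

lemma time_shift_law:
  assumes "P \<in> path_laws"
  shows "(\<lambda>\<mu>. distr \<mu> paths (time_shift s)) ` P \<in> path_laws"
proof -
  have "prob_space (distr \<mu> paths (time_shift s))" if "\<mu> \<in> P" for \<mu>
  proof (rule prob_space.prob_space_distr[OF path_lawsD(1)[OF assms that]])
    show "time_shift s \<in> \<mu> \<rightarrow>\<^sub>M paths"
      using measurable_time_shift path_lawsD(2)[OF assms that] by (simp cong: measurable_cong_sets)
  qed
  then show ?thesis using assms by (auto simp: path_laws_def)
qed

locale activation =
  fixes \<sigma> :: "real \<Rightarrow> real"
  assumes continuous_activation: "continuous_on UNIV \<sigma>"
    and bounded_activation: "bounded (range \<sigma>)"
    and nonconstant_activation: "\<not> \<sigma> constant_on UNIV"
begin

lemma measurable_activation: "\<sigma> \<in> borel_measurable borel"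
  using continuous_activation by (rule borel_measurable_continuous_onI)

lemma bounded_measurable_readout: "\<rho> \<in> readouts \<sigma> \<Longrightarrow> bounded_measurable \<rho>"
  using readouts_measurable[OF measurable_activation] readouts_bounded[OF bounded_activation]
  by (auto simp: bounded_measurable_def)

lemma readouts_subset_approximable: "readouts \<sigma> \<subseteq> approximable \<sigma>"
  by (auto simp: approximable_def bounded_measurable_readout intro!: bexI)

lemma bounded_measurable_approximable: "G \<in> approximable \<sigma> \<Longrightarrow> bounded_measurable G"
  by (simp add: approximable_def)

lemma approximableE:
  assumes "G \<in> approximable \<sigma>" "P \<in> path_laws" "\<epsilon> > 0"
  obtains \<rho> where "\<rho> \<in> readouts \<sigma>" "\<And>\<mu>. \<mu> \<in> P \<Longrightarrow> (\<integral>z. (G z - \<rho> z)\<^sup>2 \<partial>\<mu>) < \<epsilon>"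
  using assms unfolding approximable_def by blast

text \<open>Integrability of the squared difference is assumed directly, so that \<open>G\<close>
  may be an unbounded, merely square integrable functional.\<close>

lemma readouts_approx_trans:
  assumes "P \<in> path_laws" "\<epsilon> > 0" "H \<in> approximable \<sigma>"
    and int: "\<And>\<mu>. \<mu> \<in> P \<Longrightarrow> integrable \<mu> (\<lambda>z. (G z - H z)\<^sup>2)"
    and less: "\<And>\<mu>. \<mu> \<in> P \<Longrightarrow> (\<integral>z. (G z - H z)\<^sup>2 \<partial>\<mu>) < \<epsilon> / 4"
  shows "\<exists>\<rho>\<in>readouts \<sigma>. \<forall>\<mu>\<in>P. (\<integral>z. (G z - \<rho> z)\<^sup>2 \<partial>\<mu>) < \<epsilon>"
proof -
  obtain \<rho> where \<rho>: "\<rho> \<in> readouts \<sigma>" "\<And>\<mu>. \<mu> \<in> P \<Longrightarrow> (\<integral>z. (H z - \<rho> z)\<^sup>2 \<partial>\<mu>) < \<epsilon> / 4"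
    using approximableE[OF assms(3,1), of "\<epsilon> / 4"] assms(2) by auto
  have "(\<integral>z. (G z - \<rho> z)\<^sup>2 \<partial>\<mu>) < \<epsilon>" if \<mu>: "\<mu> \<in> P" for \<mu>
  proof -
    have "(\<integral>z. ((G z - H z) + (H z - \<rho> z))\<^sup>2 \<partial>\<mu>)
        \<le> 2 * (\<integral>z. (G z - H z)\<^sup>2 \<partial>\<mu>) + 2 * (\<integral>z. (H z - \<rho> z)\<^sup>2 \<partial>\<mu>)"
      by (intro integral_square_add_le int[OF \<mu>] bounded_measurable_integrable_square[OF assms(1) \<mu>]
          bounded_measurable_diff bounded_measurable_approximable assms(3) bounded_measurable_readout \<rho>(1))
    then show ?thesis using less[OF \<mu>] \<rho>(2)[OF \<mu>] by simp
  qed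
  then show ?thesis using \<rho>(1) by blast
qed

lemma approximable_trans:
  fixes G :: "(int \<Rightarrow> real ^ 'd::finite) \<Rightarrow> real"
  assumes G: "bounded_measurable G"
    and H: "\<And>P \<epsilon>. P \<in> path_laws \<Longrightarrow> \<epsilon> > 0 \<Longrightarrow>
      \<exists>H\<in>approximable \<sigma>. \<forall>\<mu>\<in>P. (\<integral>z. (G z - H z)\<^sup>2 \<partial>\<mu>) < \<epsilon>"
  shows "G \<in> approximable \<sigma>"
proof -
  have "\<exists>\<rho>\<in>readouts \<sigma>. \<forall>\<mu>\<in>P. (\<integral>z. (G z - \<rho> z)\<^sup>2 \<partial>\<mu>) < \<epsilon>"
    if P: "P \<in> path_laws" and "\<epsilon> > 0" for P \<epsilon>
  proof -
    obtain H where H: "H \<in> approximable \<sigma>" "\<And>\<mu>. \<mu> \<in> P \<Longrightarrow> (\<integral>z. (G z - H z)\<^sup>2 \<partial>\<mu>) < \<epsilon> / 4"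
      using assms(2)[OF P, of "\<epsilon> / 4"] \<open>\<epsilon> > 0\<close> by auto
    have "integrable \<mu> (\<lambda>z. (G z - H z)\<^sup>2)" if "\<mu> \<in> P" for \<mu>
      by (intro bounded_measurable_integrable_square[OF P that] bounded_measurable_diff G
          bounded_measurable_approximable H(1))
    then show ?thesis using H by (intro readouts_approx_trans[OF P \<open>\<epsilon> > 0\<close> H(1)]) auto
  qed
  then show ?thesis using G by (simp add: approximable_def)
qed

lemma approximable_add:
  fixes F G :: "(int \<Rightarrow> real ^ 'd::finite) \<Rightarrow> real"
  assumes "F \<in> approximable \<sigma>" "G \<in> approximable \<sigma>"
  shows "(\<lambda>z. F z + G z) \<in> approximable \<sigma>"
proof (rule approximable_trans)
  fix P :: "(int \<Rightarrow> real ^ 'd) measure set" and \<epsilon> :: real assume P: "P \<in> path_laws" and "\<epsilon> > 0"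
  then have \<epsilon>: "\<epsilon> / 4 > 0" by simp
  obtain \<rho> where \<rho>: "\<rho> \<in> readouts \<sigma>" "\<And>\<mu>. \<mu> \<in> P \<Longrightarrow> (\<integral>z. (F z - \<rho> z)\<^sup>2 \<partial>\<mu>) < \<epsilon> / 4"
    using approximableE[OF assms(1) P \<epsilon>] by blast
  obtain \<rho>' where \<rho>': "\<rho>' \<in> readouts \<sigma>" "\<And>\<mu>. \<mu> \<in> P \<Longrightarrow> (\<integral>z. (G z - \<rho>' z)\<^sup>2 \<partial>\<mu>) < \<epsilon> / 4"
    using approximableE[OF assms(2) P \<epsilon>] by blast
  have "(\<integral>z. ((F z + G z) - (\<rho> z + \<rho>' z))\<^sup>2 \<partial>\<mu>) < \<epsilon>" if \<mu>: "\<mu> \<in> P" for \<mu>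
  proof -
    have "(\<integral>z. ((F z - \<rho> z) + (G z - \<rho>' z))\<^sup>2 \<partial>\<mu>)
        \<le> 2 * (\<integral>z. (F z - \<rho> z)\<^sup>2 \<partial>\<mu>) + 2 * (\<integral>z. (G z - \<rho>' z)\<^sup>2 \<partial>\<mu>)"
      by (intro integral_square_add_le bounded_measurable_integrable_square[OF P \<mu>]
          bounded_measurable_diff bounded_measurable_approximable assms bounded_measurable_readout \<rho> \<rho>')
    moreover have "(F z - \<rho> z) + (G z - \<rho>' z) = (F z + G z) - (\<rho> z + \<rho>' z)" for z by simp
    ultimately show ?thesis using \<rho>(2)[OF \<mu>] \<rho>'(2)[OF \<mu>] by simp
  qed
  then show "\<exists>H\<in>approximable \<sigma>. \<forall>\<mu>\<in>P. (\<integral>z. ((F z + G z) - H z)\<^sup>2 \<partial>\<mu>) < \<epsilon>"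
    by (intro bexI[of _ "\<lambda>z. \<rho> z + \<rho>' z"] ballI)
       (auto intro!: subsetD[OF readouts_subset_approximable] readouts_add \<rho>(1) \<rho>'(1))
qed (intro bounded_measurable_add bounded_measurable_approximable assms)

lemma approximable_scale:
  fixes F :: "(int \<Rightarrow> real ^ 'd::finite) \<Rightarrow> real"
  assumes "F \<in> approximable \<sigma>"
  shows "(\<lambda>z. c * F z) \<in> approximable \<sigma>"
proof (rule approximable_trans)
  fix P :: "(int \<Rightarrow> real ^ 'd) measure set" and \<epsilon> :: real assume P: "P \<in> path_laws" and "\<epsilon> > 0"
  \<comment> \<open>The summand 1 keeps the tolerance well defined for \<open>c = 0\<close>.\<close>
  have pos: "c\<^sup>2 + 1 > 0" by (simp add: add_nonneg_pos)
  then have \<epsilon>: "\<epsilon> / (c\<^sup>2 + 1) > 0" using \<open>\<epsilon> > 0\<close> by simp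
  obtain \<rho> where \<rho>: "\<rho> \<in> readouts \<sigma>" "\<And>\<mu>. \<mu> \<in> P \<Longrightarrow> (\<integral>z. (F z - \<rho> z)\<^sup>2 \<partial>\<mu>) < \<epsilon> / (c\<^sup>2 + 1)"
    using approximableE[OF assms P \<epsilon>] by blast
  have "(\<integral>z. (c * F z - c * \<rho> z)\<^sup>2 \<partial>\<mu>) < \<epsilon>" if \<mu>: "\<mu> \<in> P" for \<mu>
  proof -
    have "(c * F z - c * \<rho> z)\<^sup>2 = c\<^sup>2 * (F z - \<rho> z)\<^sup>2" for z
      by (simp add: power_mult_distrib flip: right_diff_distrib)
    then have "(\<integral>z. (c * F z - c * \<rho> z)\<^sup>2 \<partial>\<mu>) = c\<^sup>2 * (\<integral>z. (F z - \<rho> z)\<^sup>2 \<partial>\<mu>)" by simp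
    also have "\<dots> \<le> (c\<^sup>2 + 1) * (\<integral>z. (F z - \<rho> z)\<^sup>2 \<partial>\<mu>)"
      by (intro mult_right_mono) auto
    also have "\<dots> < \<epsilon>" using \<rho>(2)[OF \<mu>] pos by (simp add: field_simps)
    finally show ?thesis .
  qed
  then show "\<exists>H\<in>approximable \<sigma>. \<forall>\<mu>\<in>P. (\<integral>z. (c * F z - H z)\<^sup>2 \<partial>\<mu>) < \<epsilon>"
    by (intro bexI[of _ "\<lambda>z. c * \<rho> z"] ballI)
       (auto intro!: subsetD[OF readouts_subset_approximable] readouts_scale \<rho>(1))
qed (intro bounded_measurable_scale bounded_measurable_approximable assms)

text \<open>Dominated convergence makes the error eventually small under each law, and finiteness of
  \<open>P\<close> provides a common index.\<close>

lemma dominated_square_convergence: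
  fixes G :: "nat \<Rightarrow> (int \<Rightarrow> real ^ 'd::finite) \<Rightarrow> real"
  assumes P: "P \<in> path_laws" and "\<epsilon> > 0"
    and meas: "\<And>n. G n \<in> borel_measurable paths" "h \<in> borel_measurable paths"
    and lim: "\<And>z. (\<lambda>n. G n z) \<longlonglongrightarrow> h z"
    and w: "\<And>\<mu>. \<mu> \<in> P \<Longrightarrow> integrable \<mu> w" "\<And>n z. (h z - G n z)\<^sup>2 \<le> w z"
  obtains n :: nat where "\<And>\<mu>. \<mu> \<in> P \<Longrightarrow> (\<integral>z. (h z - G n z)\<^sup>2 \<partial>\<mu>) < \<epsilon>"
proof -
  have "\<forall>\<^sub>F n in sequentially. (\<integral>z. (h z - G n z)\<^sup>2 \<partial>\<mu>) < \<epsilon>" if \<mu>: "\<mu> \<in> P" for \<mu>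
  proof -
    have [measurable]: "G n \<in> borel_measurable \<mu>" "h \<in> borel_measurable \<mu>" for n
      using meas path_lawsD(2)[OF P \<mu>] by (simp_all cong: measurable_cong_sets)
    have "(\<lambda>n. \<integral>z. (h z - G n z)\<^sup>2 \<partial>\<mu>) \<longlonglongrightarrow> (\<integral>z. 0 \<partial>\<mu>)"
    proof (rule integral_dominated_convergence[OF _ _ w(1)[OF \<mu>]])
      have "(\<lambda>n. (h z - G n z)\<^sup>2) \<longlonglongrightarrow> (h z - h z)\<^sup>2" for z by (intro tendsto_intros lim)
      then show "AE z in \<mu>. (\<lambda>n. (h z - G n z)\<^sup>2) \<longlonglongrightarrow> 0" by simp
    qed (use w(2) in auto)
    then show ?thesis using \<open>\<epsilon> > 0\<close> by (intro order_tendstoD(2)[of _ 0]) auto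
  qed
  then have "\<forall>\<^sub>F n in sequentially. \<forall>\<mu>\<in>P. (\<integral>z. (h z - G n z)\<^sup>2 \<partial>\<mu>) < \<epsilon>"
    using P by (intro eventually_ball_finite) (auto simp: path_laws_def)
  then show thesis using that by (auto simp: eventually_sequentially)
qed

lemma approximable_limit:
  fixes G :: "nat \<Rightarrow> (int \<Rightarrow> real ^ 'd::finite) \<Rightarrow> real"
  assumes G: "\<And>n. G n \<in> approximable \<sigma>" and C: "\<And>n z. \<bar>G n z\<bar> \<le> C"
    and lim: "\<And>z. (\<lambda>n::nat. G n z) \<longlonglongrightarrow> h z"
  shows "h \<in> approximable \<sigma>"
proof (rule approximable_trans)
  have G_meas: "G n \<in> borel_measurable paths" for n
    using bounded_measurable_approximable[OF G] by (simp add: bounded_measurable_def)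
  have h_meas: "h \<in> borel_measurable paths" by (rule borel_measurable_LIMSEQ_real[OF lim G_meas])
  have hC: "\<bar>h z\<bar> \<le> C" for z by (rule LIMSEQ_le_const2[OF tendsto_rabs[OF lim]]) (use C in auto)
  show "bounded_measurable h" using h_meas hC by (rule bounded_measurableI)
  fix P :: "(int \<Rightarrow> real ^ 'd) measure set" and \<epsilon> :: real assume P: "P \<in> path_laws" and \<epsilon>: "\<epsilon> > 0"
  have w: "integrable \<mu> (\<lambda>z. (2 * C)\<^sup>2)" if "\<mu> \<in> P" for \<mu> :: "(int \<Rightarrow> real ^ 'd) measure"
    using path_lawsD(1)[OF P that] by (intro finite_measure.integrable_const) (rule prob_space.finite_measure)
  have le: "(h z - G n z)\<^sup>2 \<le> (2 * C)\<^sup>2" for n z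
  proof -
    have "\<bar>h z - G n z\<bar> \<le> 2 * C" using hC[of z] C[of n z] by linarith
    then show ?thesis using power_mono[of "\<bar>h z - G n z\<bar>" "2 * C" 2] by simp
  qed
  obtain n where "\<And>\<mu>. \<mu> \<in> P \<Longrightarrow> (\<integral>z. (h z - G n z)\<^sup>2 \<partial>\<mu>) < \<epsilon>"
    using dominated_square_convergence[OF P \<epsilon> G_meas h_meas lim w le] by blast
  then show "\<exists>H\<in>approximable \<sigma>. \<forall>\<mu>\<in>P. (\<integral>z. (h z - H z)\<^sup>2 \<partial>\<mu>) < \<epsilon>"
    by (intro bexI[of _ "G n"] ballI G)
qed

lemma bp_closure_approximable:
  assumes "G \<in> bp_closure F" "F \<subseteq> approximable \<sigma>"
  shows "G \<in> approximable \<sigma>"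
  using assms(1)
proof induction
  case (limit G C h)
  show ?case by (rule approximable_limit[OF limit.IH limit.hyps(2,3)])
qed (use assms(2) in \<open>auto intro: approximable_add approximable_scale\<close>)

text \<open>A dilate of \<open>\<sigma>\<close> applied to the delayed readout plus the current
  input is the output of one appended neuron. The cosine is in the closure of the dilates, so
  composition gives the claim.\<close>

lemma cos_readout_approximable:
  assumes "\<rho> \<in> readouts \<sigma>"
  shows "(\<lambda>z. cos (\<rho> (time_shift (-1) z) + (\<Sum>k\<in>UNIV. W k * z 0 $ k) + \<phi>)) \<in> approximable \<sigma>"
proof -
  let ?u = "\<lambda>z. \<rho> (time_shift (-1) z) + (\<Sum>k\<in>UNIV. W k * z 0 $ k)"
  have "(\<lambda>z. cos (1 * ?u z + \<phi>)) \<in> bp_closure (readouts \<sigma>)"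
  proof (rule bp_closure_compose[OF cos_mem_bp_closure_dilates])
    fix f assume "f \<in> dilates \<sigma>"
    then obtain c b where "f = (\<lambda>x. \<sigma> (c * x + b))" by (auto simp: dilates_def)
    then show "(\<lambda>z. f (?u z)) \<in> bp_closure (readouts \<sigma>)"
      using readouts_append[OF assms, of c W b] by (auto intro: bp_closure.base)
  qed (rule continuous_activation bounded_activation nonconstant_activation)+
  then show ?thesis using bp_closure_approximable[OF _ readouts_subset_approximable] by simp
qed

lemma abs_cos_diff_le: "\<bar>cos x - cos y\<bar> \<le> \<bar>x - y\<bar>" for x y :: real
proof -
  have "\<bar>cos x - cos y\<bar> = 2 * (\<bar>sin ((x + y) / 2)\<bar> * \<bar>sin ((y - x) / 2)\<bar>)"
    by (simp add: cos_diff_cos abs_mult)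
  also have "\<dots> \<le> 2 * (1 * \<bar>(y - x) / 2\<bar>)"
    by (intro mult_left_mono mult_mono abs_sin_x_le_abs_x) auto
  finally show ?thesis by simp
qed

text \<open>The cosine is 1-Lipschitz, so replacing \<open>h\<close> by a readout
  \<open>\<rho>\<close> costs at most their mean square distance after the delay. That is the
  distance under the shifted laws, for which \<open>\<rho>\<close> is chosen.\<close>

lemma cos_approximable:
  fixes h :: "(int \<Rightarrow> real ^ 'd::finite) \<Rightarrow> real"
  assumes h: "h \<in> approximable \<sigma>"
  shows "(\<lambda>z. cos (h (time_shift (-1) z) + (\<Sum>k\<in>UNIV. W k * z 0 $ k) + \<phi>)) \<in> approximable \<sigma>"
    (is "?G \<in> _")
proof (rule approximable_trans)
  have h_meas: "h \<in> borel_measurable paths"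
    using bounded_measurable_approximable[OF h] by (simp add: bounded_measurable_def)
  have [measurable]: "(\<lambda>z. h (time_shift (-1) z)) \<in> borel_measurable paths"
    by (rule measurable_compose[OF measurable_time_shift h_meas])
  show G: "bounded_measurable ?G" by (rule bounded_measurableI[of _ 1]) auto
  fix P :: "(int \<Rightarrow> real ^ 'd) measure set" and \<epsilon> :: real assume P: "P \<in> path_laws" and "\<epsilon> > 0"
  obtain \<rho> where \<rho>: "\<rho> \<in> readouts \<sigma>"
    and "\<And>\<mu>. \<mu> \<in> (\<lambda>\<mu>. distr \<mu> paths (time_shift (-1))) ` P \<Longrightarrow> (\<integral>z. (h z - \<rho> z)\<^sup>2 \<partial>\<mu>) < \<epsilon>"
    by (rule approximableE[OF h time_shift_law[OF P] \<open>\<epsilon> > 0\<close>]) blast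
  then have \<rho>_less: "(\<integral>z. (h z - \<rho> z)\<^sup>2 \<partial>distr \<mu> paths (time_shift (-1))) < \<epsilon>" if "\<mu> \<in> P" for \<mu>
    using that by blast
  let ?H = "\<lambda>z. cos (\<rho> (time_shift (-1) z) + (\<Sum>k\<in>UNIV. W k * z 0 $ k) + \<phi>)"
  have "(\<integral>z. (?G z - ?H z)\<^sup>2 \<partial>\<mu>) < \<epsilon>" if \<mu>: "\<mu> \<in> P" for \<mu>
  proof -
    have b: "bounded_measurable (\<lambda>z. h z - \<rho> z)"
      by (intro bounded_measurable_diff bounded_measurable_approximable h bounded_measurable_readout \<rho>)
    have shift: "time_shift (-1) \<in> \<mu> \<rightarrow>\<^sub>M paths"
      using measurable_time_shift path_lawsD(2)[OF P \<mu>] by (simp cong: measurable_cong_sets)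
    have meas: "(\<lambda>z. (h z - \<rho> z)\<^sup>2) \<in> borel_measurable paths"
      using b by (auto simp: bounded_measurable_def)
    have "integrable (distr \<mu> paths (time_shift (-1))) (\<lambda>z. (h z - \<rho> z)\<^sup>2)"
      using \<mu> by (intro bounded_measurable_integrable_square[OF time_shift_law[OF P] _ b]) auto
    then have int: "integrable \<mu> (\<lambda>z. (h (time_shift (-1) z) - \<rho> (time_shift (-1) z))\<^sup>2)"
      by (rule integrable_distr[OF shift])
    have "(\<integral>z. (?G z - ?H z)\<^sup>2 \<partial>\<mu>) \<le> (\<integral>z. (h (time_shift (-1) z) - \<rho> (time_shift (-1) z))\<^sup>2 \<partial>\<mu>)"
    proof (rule integral_mono'[OF int])
      fix z
      show "(?G z - ?H z)\<^sup>2 \<le> (h (time_shift (-1) z) - \<rho> (time_shift (-1) z))\<^sup>2"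
        unfolding abs_le_square_iff[symmetric] by (rule order_trans[OF abs_cos_diff_le]) simp
    qed simp
    also have "\<dots> = (\<integral>z. (h z - \<rho> z)\<^sup>2 \<partial>distr \<mu> paths (time_shift (-1)))"
      by (rule integral_distr[OF shift meas, symmetric])
    finally show ?thesis using \<rho>_less[OF \<mu>] by simp
  qed
  then show "\<exists>H\<in>approximable \<sigma>. \<forall>\<mu>\<in>P. (\<integral>z. (?G z - H z)\<^sup>2 \<partial>\<mu>) < \<epsilon>"
    by (intro bexI[of _ ?H] ballI cos_readout_approximable \<rho>)
qed

end

subsection \<open>Square integrable functionals of the past\<close>

text \<open>The recursion mirrors a network layer, one delay followed by the current input, so
  induction over it meets the form of \<open>cos_approximable\<close>.\<close>

inductive_set past_linear :: "((int \<Rightarrow> real ^ 'd::finite) \<Rightarrow> real) set" where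
  zero: "(\<lambda>z. 0) \<in> past_linear"
| step: "h \<in> past_linear \<Longrightarrow>
    (\<lambda>z. h (time_shift (-1) z) + (\<Sum>k\<in>UNIV. W k * z 0 $ k)) \<in> past_linear"

lemma past_linear_add:
  assumes "h \<in> past_linear" "h' \<in> past_linear"
  shows "(\<lambda>z. h z + h' z) \<in> past_linear"
  using assms
proof (induction arbitrary: h')
  case (step h W)
  from step.prems show ?case
  proof cases
    case zero
    then show ?thesis using past_linear.step[OF step.hyps(1), of W] by simp
  next
    case (step h1 V)
    then show ?thesis
      using past_linear.step[OF \<open>\<And>h'. h' \<in> past_linear \<Longrightarrow> (\<lambda>z. h z + h' z) \<in> past_linear\<close>[OF step(2)],
          of "\<lambda>k. W k + V k"]
      by (simp add: distrib_right sum.distrib add_ac)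
  qed
qed simp

lemma past_linear_scale:
  assumes "h \<in> past_linear"
  shows "(\<lambda>z. c * h z) \<in> past_linear"
  using assms
proof induction
  case (step h W)
  show ?case
    using past_linear.step[OF step.IH, of "\<lambda>k. c * W k"]
    by (simp add: distrib_left sum_distrib_left mult.assoc)
qed (simp add: past_linear.zero)

lemma past_linear_coordinate: "(\<lambda>z. z (- int j) $ k) \<in> past_linear"
proof (induction j)
  case 0
  have "(\<Sum>l\<in>UNIV. (if l = k then 1 else 0) * z 0 $ l) = z 0 $ k" for z :: "int \<Rightarrow> real ^ 'a"
    by (simp add: if_distrib[of "\<lambda>x. x * _"] cong: if_cong)
  then show ?case using past_linear.step[OF past_linear.zero, of "\<lambda>l. if l = k then 1 else 0"] by simp
next
  case (Suc j)
  show ?case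
    using past_linear.step[OF Suc, of "\<lambda>_. 0"] by (simp add: time_shift_apply algebra_simps)
qed

interpretation past_linear: function_subspace past_linear
  by unfold_locales (auto intro: past_linear.zero past_linear_add past_linear_scale)

text \<open>These are the difference quotients at 0 of \<open>sin (x * t)\<close> for the increments
  \<open>1 / Suc n\<close>.\<close>

lemma Suc_mult_sin_tendsto: "(\<lambda>n. Suc n * sin (x / Suc n)) \<longlonglongrightarrow> x" for x :: real
proof -
  have "((\<lambda>t. sin (x * t)) has_real_derivative x) (at 0)"
    by (auto intro!: derivative_eq_intros)
  then have lim: "((\<lambda>t. sin (x * t) / t) \<longlongrightarrow> x) (at 0)" by (simp add: DERIV_def)
  have "filterlim (\<lambda>n. 1 / real (Suc n)) (at 0) sequentially"
    unfolding filterlim_at using LIMSEQ_Suc[OF lim_1_over_n] by auto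
  from filterlim_compose[OF lim this] show ?thesis by (simp add: mult.commute)
qed

context activation
begin

text \<open>The scaled sine \<open>n sin (h / n)\<close> is approximable by induction and tends to \<open>h\<close>; it carries
  the inputs of earlier times, which the activation function cannot transmit unchanged.\<close>

lemma cos_past_linear_approximable:
  assumes "h \<in> past_linear"
  shows "(\<lambda>z. cos (a * h z + \<phi>)) \<in> approximable \<sigma>"
  using assms
proof (induction arbitrary: a \<phi>)
  case zero
  have "(\<lambda>z. 0) \<in> readouts \<sigma>" by (rule readoutsI[of 1 _ "\<lambda>_. 0"]) auto
  then have "(\<lambda>z. 0) \<in> approximable \<sigma>" using readouts_subset_approximable by auto
  from cos_approximable[OF this, of "\<lambda>_. 0" \<phi>] show ?case by simp
next
  case (step h W)
  define G where "G n z = cos (real (Suc n) * sin (a * h (time_shift (-1) z) / Suc n)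
      + (\<Sum>k\<in>UNIV. (a * W k) * z 0 $ k) + \<phi>)" for n and z :: "int \<Rightarrow> real ^ 'a"
  have "G n \<in> approximable \<sigma>" for n
  proof -
    \<comment> \<open>The phase \<open>- (pi / 2)\<close> turns the cosine of the induction
      hypothesis into a sine.\<close>
    have "(\<lambda>z. real (Suc n) * cos (a / Suc n * h z + - (pi / 2))) \<in> approximable \<sigma>"
      by (intro approximable_scale step.IH)
    moreover have "cos (x - pi / 2) = sin x" for x :: real by (simp add: cos_diff)
    ultimately have "(\<lambda>z. real (Suc n) * sin (a * h z / Suc n)) \<in> approximable \<sigma>" by simp
    from cos_approximable[OF this] show ?thesis unfolding G_def .
  qed
  moreover have "\<bar>G n z\<bar> \<le> 1" for n z by (simp add: G_def)
  moreover have "(\<lambda>n. G n z) \<longlonglongrightarrow>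
      cos (a * h (time_shift (-1) z) + (\<Sum>k\<in>UNIV. (a * W k) * z 0 $ k) + \<phi>)" for z
    unfolding G_def by (intro tendsto_cos tendsto_add tendsto_const Suc_mult_sin_tendsto)
  ultimately have "(\<lambda>z. cos (a * h (time_shift (-1) z) + (\<Sum>k\<in>UNIV. (a * W k) * z 0 $ k) + \<phi>))
      \<in> approximable \<sigma>"
    by (rule approximable_limit)
  then show ?case by (simp add: distrib_left sum_distrib_left mult.assoc)
qed

lemma trig_past_approximable: "past_linear.trig \<subseteq> approximable \<sigma>"
proof
  fix G :: "(int \<Rightarrow> real ^ 'd) \<Rightarrow> real" assume "G \<in> past_linear.trig"
  then show "G \<in> approximable \<sigma>"
  proof (rule bp_closure_approximable)
    show "cosines past_linear \<subseteq> approximable \<sigma>"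
      using cos_past_linear_approximable[of _ 1] by (auto simp: cosines_def)
  qed
qed

end

text \<open>Freezing a path after time 0 expresses dependence on the past by composition: a causal
  functional at time 0 is unchanged by it, and everything stays on the full path space.\<close>

definition stop :: "(int \<Rightarrow> 'a) \<Rightarrow> int \<Rightarrow> 'a" where
  "stop z j = z (min j 0)"

lemma measurable_stop [measurable]: "stop \<in> paths \<rightarrow>\<^sub>M paths"
  by (rule measurable_pathsI) (simp add: stop_def)

text \<open>The sets with indicator in \<open>trig\<close> form a sigma-algebra for which every
  coordinate of \<open>stop\<close> is measurable, since rays of past-linear functionals belong to
  it. Hence \<open>stop\<close> itself is measurable.\<close>

lemma indicator_vimage_stop_mem_trig:
  assumes "A \<in> sets (paths :: (int \<Rightarrow> real ^ 'd::finite) measure)"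
  shows "(indicator (stop -` A) :: _ \<Rightarrow> real) \<in> past_linear.trig"
proof -
  define N :: "(int \<Rightarrow> real ^ 'd) measure"
    where "N = sigma UNIV {A. (indicator A :: _ \<Rightarrow> real) \<in> past_linear.trig}"
  have sets_N: "sets N = {A. (indicator A :: _ \<Rightarrow> real) \<in> past_linear.trig}" and space_N: "space N = UNIV"
    using sigma_algebra.sets_measure_of_eq[OF past_linear.sigma_algebra_trig]
    by (auto simp: N_def space_measure_of_conv)
  have "stop \<in> N \<rightarrow>\<^sub>M (paths :: (int \<Rightarrow> real ^ 'd) measure)"
  proof (rule measurable_pathsI)
    fix i :: int
    show "(\<lambda>z. stop z i) \<in> borel_measurable N"
      unfolding borel_measurable_vec_iff
    proof
      fix k :: 'd
      have "min i 0 = - int (nat (- min i 0))" by simp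
      then have "(\<lambda>z. stop z i $ k) \<in> past_linear"
        using past_linear_coordinate[of "nat (- min i 0)" k] by (simp only: stop_def)
      from past_linear.indicator_greater_mem_trig[OF this]
      show "(\<lambda>z. stop z i $ k) \<in> borel_measurable N"
        unfolding borel_measurable_iff_greater space_N sets_N by simp
    qed
  qed
  from measurable_sets[OF this assms] show ?thesis by (simp add: sets_N space_N)
qed

context activation
begin

text \<open>Simple functions with \<open>\<bar>s i z\<bar> \<le> 2 * \<bar>F z\<bar>\<close>
  converge to \<open>F\<close>, and the squared error is dominated by
  \<open>9 * (F (stop z))\<^sup>2\<close>. Each of them, composed with \<open>stop\<close>, lies in
  \<open>trig\<close> and is approximable.\<close>

lemma square_integrable_past_approx:
  fixes F :: "(int \<Rightarrow> real ^ 'd::finite) \<Rightarrow> real"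
  assumes F: "F \<in> borel_measurable paths" and P: "P \<in> path_laws" and "\<epsilon> > 0"
    and int: "\<And>\<mu>. \<mu> \<in> P \<Longrightarrow> integrable \<mu> (\<lambda>z. (F (stop z))\<^sup>2)"
  shows "\<exists>\<rho>\<in>readouts \<sigma>. \<forall>\<mu>\<in>P. (\<integral>z. (F (stop z) - \<rho> z)\<^sup>2 \<partial>\<mu>) < \<epsilon>"
proof -
  obtain s where s: "\<And>i. simple_function paths (s i)" "\<And>z. (\<lambda>i. s i z) \<longlonglongrightarrow> F z"
    "\<And>i z. \<bar>s i z\<bar> \<le> 2 * \<bar>F z\<bar>"
    using borel_measurable_implies_sequence_metric[OF F, of 0] by (auto simp: space_paths dist_real_def)
  have approx: "(\<lambda>z. s i (stop z)) \<in> approximable \<sigma>" for i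
    using past_linear.simple_function_mem_trig[OF s(1) space_paths indicator_vimage_stop_mem_trig]
      trig_past_approximable by blast
  have s_meas: "(\<lambda>z. s i (stop z)) \<in> borel_measurable paths" for i
    using bounded_measurable_approximable[OF approx] by (simp add: bounded_measurable_def)
  have F_meas: "(\<lambda>z. F (stop z)) \<in> borel_measurable paths"
    by (rule measurable_compose[OF measurable_stop F])
  have le: "(F (stop z) - s i (stop z))\<^sup>2 \<le> 9 * (F (stop z))\<^sup>2" for i z
  proof -
    have "\<bar>F (stop z) - s i (stop z)\<bar> \<le> \<bar>3 * F (stop z)\<bar>" using s(3)[of i "stop z"] by linarith
    then show ?thesis by (simp add: abs_le_square_iff power_mult_distrib)
  qed
  have "\<epsilon> / 4 > 0" using \<open>\<epsilon> > 0\<close> by simp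
  have int9: "integrable \<mu> (\<lambda>z. 9 * (F (stop z))\<^sup>2)" if "\<mu> \<in> P" for \<mu> using int[OF that] by simp
  obtain i where i: "\<And>\<mu>. \<mu> \<in> P \<Longrightarrow> (\<integral>z. (F (stop z) - s i (stop z))\<^sup>2 \<partial>\<mu>) < \<epsilon> / 4"
    using dominated_square_convergence[OF P \<open>\<epsilon> / 4 > 0\<close> s_meas F_meas s(2) int9 le] by blast
  show ?thesis
  proof (rule readouts_approx_trans[OF P \<open>\<epsilon> > 0\<close> approx _ i])
    fix \<mu> assume \<mu>: "\<mu> \<in> P"
    have "(\<lambda>z. (F (stop z) - s i (stop z))\<^sup>2) \<in> borel_measurable \<mu>"
      using s_meas F_meas path_lawsD(2)[OF P \<mu>] by (auto cong: measurable_cong_sets)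
    then show "integrable \<mu> (\<lambda>z. (F (stop z) - s i (stop z))\<^sup>2)"
      by (rule Bochner_Integration.integrable_bound[OF int9[OF \<mu>]]) (use le in auto)
  qed
qed

end

section \<open>From scalar functionals to vector-valued filters along the process\<close>

lemma norm_vec_power2: "(norm x)\<^sup>2 = (\<Sum>k\<in>UNIV. (x $ k)\<^sup>2)" for x :: "real ^ 'd::finite"
  unfolding power2_norm_eq_inner inner_vec_def by (simp add: power2_eq_square)

lemma in_L2_component_integrable:
  assumes "in_L2 M Z"
  shows "integrable M (\<lambda>\<omega>. (Z \<omega> $ k)\<^sup>2)"
proof (rule Bochner_Integration.integrable_bound)
  show "integrable M (\<lambda>\<omega>. (norm (Z \<omega>))\<^sup>2)" using assms by (simp add: in_L2_def)
  have "(\<lambda>\<omega>. Z \<omega> $ k) \<in> borel_measurable M"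
    using assms borel_measurable_vec_iff[of Z M] by (simp add: in_L2_def)
  then show "(\<lambda>\<omega>. (Z \<omega> $ k)\<^sup>2) \<in> borel_measurable M" by simp
  show "AE \<omega> in M. norm ((Z \<omega> $ k)\<^sup>2) \<le> norm ((norm (Z \<omega>))\<^sup>2)"
    by (rule AE_I2) (simp add: norm_vec_power2 sum_nonneg member_le_sum[of k UNIV "\<lambda>k. (Z _ $ k)\<^sup>2"])
qed

lemma in_L2I_components:
  assumes "\<And>k. (\<lambda>\<omega>. Z \<omega> $ k) \<in> borel_measurable M" "\<And>k. integrable M (\<lambda>\<omega>. (Z \<omega> $ k)\<^sup>2)"
  shows "in_L2 M Z"
  using assms by (simp add: in_L2_def borel_measurable_vec_iff norm_vec_power2)

text \<open>The trajectory shifted by \<open>t\<close> extends the re-indexed past, causality allows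
  this extension to be used, and time invariance moves the shift outside the filter.\<close>

lemma filter_functional_past:
  assumes "causal V" "time_invariant V"
  shows "filter_functional V (past Y t \<omega>) = V (\<lambda>j. Y j \<omega>) t"
proof -
  have "filter_functional V (past Y t \<omega>) = V (time_shift t (\<lambda>j. Y j \<omega>)) 0"
    by (rule filter_functional_extension[OF assms(1)]) (simp add: past_def time_shift_apply add.commute)
  also have "\<dots> = time_shift t (V (\<lambda>j. Y j \<omega>)) 0"
    using assms(2) by (metis comp_apply time_invariant_def)
  finally show ?thesis by (simp add: time_shift_apply)
qed

text \<open>By time invariance an error at time \<open>t\<close> is an error at time 0 under the law
  of the trajectory shifted by \<open>t\<close>. Finitely many times give finitely many laws,
  handled by one network whose readouts supply all coordinates.\<close>

lemma (in activation) esn_approximates_filter: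
  fixes Y :: "int \<Rightarrow> 'w \<Rightarrow> real ^ 'd::finite" and U :: "(int \<Rightarrow> real ^ 'd) \<Rightarrow> (int \<Rightarrow> real ^ 'd)"
  assumes M: "prob_space M" and Y: "\<And>k. Y k \<in> borel_measurable M"
    and U: "seq_filter U" "causal U" "time_invariant U"
    and L2: "\<And>t. t \<in> Ts \<Longrightarrow> in_L2 M (\<lambda>\<omega>. U (\<lambda>j. Y j \<omega>) t)"
    and "finite Ts" "\<epsilon> > 0"
  obtains N A Win \<zeta> w where "0 < N"
    "\<And>t. t \<in> Ts \<Longrightarrow> in_L2 M (\<lambda>\<omega>. esn_filter \<sigma> N (lower A) Win \<zeta> w (\<lambda>j. Y j \<omega>) t)"
    "\<And>t. t \<in> Ts \<Longrightarrow>
      norm_L2 M (\<lambda>\<omega>. U (\<lambda>j. Y j \<omega>) t - esn_filter \<sigma> N (lower A) Win \<zeta> w (\<lambda>j. Y j \<omega>) t) < \<epsilon>"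
proof -
  define S where "S t \<omega> = time_shift t (\<lambda>j. Y j \<omega>)" for t \<omega>
  have S [measurable]: "S t \<in> M \<rightarrow>\<^sub>M paths" for t
    by (rule measurable_pathsI) (simp add: S_def time_shift_apply Y)
  define P where "P = (\<lambda>t. distr M paths (S t)) ` Ts"
  have P: "P \<in> path_laws"
    using prob_space.prob_space_distr[OF M S] \<open>finite Ts\<close> by (auto simp: path_laws_def P_def)
  define F where "F k z = U z 0 $ k" for k z
  have F_stop: "F k (stop z) = F k z" for k z
  proof -
    have "\<forall>s\<le>0. stop z s = z s" by (simp add: stop_def)
    then show ?thesis using U(2) unfolding causal_def F_def by metis
  qed
  have F_meas: "F k \<in> borel_measurable paths" for k
  proof -
    have "(\<lambda>z. U z 0) \<in> borel_measurable paths"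
      using U(1) unfolding seq_filter_def by (rule measurable_compose[OF _ measurable_path_component])
    then show ?thesis unfolding F_def borel_measurable_vec_iff by blast
  qed
  have F_S: "F k (S t \<omega>) = U (\<lambda>j. Y j \<omega>) t $ k" for k t \<omega>
  proof -
    have "U (S t \<omega>) = time_shift t (U (\<lambda>j. Y j \<omega>))"
      unfolding S_def using U(3) by (metis comp_apply time_invariant_def)
    then show ?thesis by (simp add: F_def time_shift_apply)
  qed
  have F_int: "integrable (distr M paths (S t)) (\<lambda>z. (F k z)\<^sup>2)" if "t \<in> Ts" for t k
    using in_L2_component_integrable[OF L2[OF that], of k] F_meas
    by (subst integrable_distr_eq[OF S]) (auto simp: F_S)
  \<comment> \<open>The squared tolerance is divided equally among the coordinates.\<close>
  define \<delta> where "\<delta> = \<epsilon>\<^sup>2 / CARD('d)"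
  have "\<delta> > 0" using \<open>\<epsilon> > 0\<close> by (simp add: \<delta>_def)
  have "\<exists>\<rho>\<in>readouts \<sigma>. \<forall>\<mu>\<in>P. (\<integral>z. (F k z - \<rho> z)\<^sup>2 \<partial>\<mu>) < \<delta>" for k
    using square_integrable_past_approx[OF F_meas P \<open>\<delta> > 0\<close>, of k] F_int
    by (auto simp: F_stop P_def)
  then obtain \<rho> where \<rho>: "\<And>k. \<rho> k \<in> readouts \<sigma>"
    and "\<And>k \<mu>. \<mu> \<in> P \<Longrightarrow> (\<integral>z. (F k z - \<rho> k z)\<^sup>2 \<partial>\<mu>) < \<delta>" by metis
  then have \<rho>_less: "(\<integral>z. (F k z - \<rho> k z)\<^sup>2 \<partial>distr M paths (S t)) < \<delta>" if "t \<in> Ts" for k t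
    using that by (simp add: P_def)
  obtain N A Win \<zeta> w where "0 < N"
    and w: "\<And>k. \<rho> k = (\<lambda>z. \<Sum>i<N. w i k * neuron \<sigma> A Win \<zeta> i z)"
    using readouts_common_network[of UNIV \<rho> \<sigma>, OF finite \<rho>] unfolding ball_UNIV by blast
  let ?V = "esn_filter \<sigma> N (lower A) Win \<zeta> w"
  have V: "?V (\<lambda>j. Y j \<omega>) t $ k = \<rho> k (S t \<omega>)" for \<omega> t k
    by (simp add: esn_filter_lower w S_def)
  have \<rho>_meas [measurable]: "\<rho> k \<in> borel_measurable paths" for k
    using readouts_measurable[OF measurable_activation \<rho>] .
  have \<rho>_int: "integrable (distr M paths (S t)) (\<lambda>z. (\<rho> k z)\<^sup>2)" if "t \<in> Ts" for k t
    using that by (intro bounded_measurable_integrable_square[OF P] bounded_measurable_readout \<rho>) (simp add: P_def)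
  show thesis
  proof (rule that[OF \<open>0 < N\<close>])
    fix t assume t: "t \<in> Ts"
    show "in_L2 M (\<lambda>\<omega>. ?V (\<lambda>j. Y j \<omega>) t)"
      by (rule in_L2I_components) (auto simp: V intro: integrable_distr[OF S \<rho>_int[OF t]])
    have diff_int: "integrable (distr M paths (S t)) (\<lambda>z. (F k z - \<rho> k z)\<^sup>2)" for k
    proof (rule Bochner_Integration.integrable_bound)
      show "integrable (distr M paths (S t)) (\<lambda>z. 2 * (F k z)\<^sup>2 + 2 * (\<rho> k z)\<^sup>2)"
        using F_int[OF t] \<rho>_int[OF t] by simp
      show "(\<lambda>z. (F k z - \<rho> k z)\<^sup>2) \<in> borel_measurable (distr M paths (S t))"
        using F_meas \<rho>_meas by simp
      have "(a - b)\<^sup>2 \<le> 2 * a\<^sup>2 + 2 * b\<^sup>2" for a b :: real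
        using zero_le_power2[of "a + b"] by (simp add: power2_eq_square algebra_simps)
      then show "AE z in distr M paths (S t). norm ((F k z - \<rho> k z)\<^sup>2) \<le> norm (2 * (F k z)\<^sup>2 + 2 * (\<rho> k z)\<^sup>2)"
        by simp
    qed
    have "(\<integral>\<omega>. (norm (U (\<lambda>j. Y j \<omega>) t - ?V (\<lambda>j. Y j \<omega>) t))\<^sup>2 \<partial>M)
        = (\<integral>\<omega>. (\<Sum>k\<in>UNIV. (F k (S t \<omega>) - \<rho> k (S t \<omega>))\<^sup>2) \<partial>M)"
      by (simp add: norm_vec_power2 F_S V)
    also have "\<dots> = (\<Sum>k\<in>UNIV. \<integral>\<omega>. (F k (S t \<omega>) - \<rho> k (S t \<omega>))\<^sup>2 \<partial>M)"
      by (rule Bochner_Integration.integral_sum) (rule integrable_distr[OF S diff_int])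
    also have "\<dots> = (\<Sum>k\<in>UNIV. \<integral>z. (F k z - \<rho> k z)\<^sup>2 \<partial>distr M paths (S t))"
      using F_meas by (intro sum.cong refl integral_distr[OF S, symmetric]) auto
    also have "\<dots> < (\<Sum>k\<in>(UNIV :: 'd set). \<delta>)"
      using \<rho>_less[OF t] by (intro sum_strict_mono) auto
    also have "\<dots> = \<epsilon>\<^sup>2" by (simp add: \<delta>_def)
    finally have "norm_L2 M (\<lambda>\<omega>. U (\<lambda>j. Y j \<omega>) t - ?V (\<lambda>j. Y j \<omega>) t) < sqrt (\<epsilon>\<^sup>2)"
      unfolding norm_L2_def by (rule real_sqrt_less_mono)
    then show "norm_L2 M (\<lambda>\<omega>. U (\<lambda>j. Y j \<omega>) t - ?V (\<lambda>j. Y j \<omega>) t) < \<epsilon>"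
      using \<open>\<epsilon> > 0\<close> by simp
  qed
qed

theorem theorem2:
  fixes M :: "'w measure"
    and T dt :: real
    and B :: "real \<Rightarrow> 'w \<Rightarrow> real ^ 'd"
    and g :: "real ^ 'd ^ 'd"
    and \<theta> :: "int \<Rightarrow> real"
    and X :: "real \<Rightarrow> 'w \<Rightarrow> real ^ 'd"
    and Y :: "int \<Rightarrow> 'w \<Rightarrow> real ^ 'd"
    and \<sigma> :: "real \<Rightarrow> real"
    and U :: "(int \<Rightarrow> real ^ 'd) \<Rightarrow> (int \<Rightarrow> real ^ 'd)"
    and t :: int
  assumes "prob_space M" and "T > 0" and "dt > 0"
    and "brownian_motion M B"
    and "positive_diagonal g"
    and "time_grid T dt \<theta>"
    and "(\<exists>f. lipschitz_growth f \<and> solves_sde M T f g B X \<and> euler_maruyama_sde M f g B \<theta> Y) \<or>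
         (\<exists>f \<tau> \<gamma>. \<tau> > 0 \<and> lipschitz_growth f \<and> solves_sdde M T \<tau> \<gamma> f g B X \<and>
            euler_maruyama_sdde M T \<tau> \<gamma> f g B \<theta> Y)"
    and "\<And>k. in_L2 M (Y k)"
    and "continuous_on UNIV \<sigma>" and "bounded (range \<sigma>)" and "\<not> \<sigma> constant_on UNIV"
    and "seq_filter U" and "causal U" and "time_invariant U"
    and "\<And>k. AE \<omega> in M. U (\<lambda>j. Y j \<omega>) k = Y (k + 1) \<omega>"
  shows "(\<forall>\<epsilon>>0. \<exists>N A Win \<zeta> w. 0 < N \<and>
            echo_state_property \<sigma> N A Win \<zeta> \<and>
            seq_filter (esn_filter \<sigma> N A Win \<zeta> w) \<and>
            causal (esn_filter \<sigma> N A Win \<zeta> w) \<and>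
            time_invariant (esn_filter \<sigma> N A Win \<zeta> w) \<and>
            in_L2 M (\<lambda>\<omega>. filter_functional (esn_filter \<sigma> N A Win \<zeta> w) (past Y t \<omega>)) \<and>
            norm_L2 M (\<lambda>\<omega>. filter_functional U (past Y t \<omega>)
                          - filter_functional (esn_filter \<sigma> N A Win \<zeta> w) (past Y t \<omega>)) < \<epsilon>) \<and>
         (\<forall>s. \<forall>\<epsilon>>0. \<exists>U' Us.
            is_esn_filter \<sigma> U' \<and> causal U' \<and> time_invariant U' \<and>
            is_esn_filter \<sigma> Us \<and> causal Us \<and> time_invariant Us \<and>
            constructed_by M \<epsilon> (filter_functional U) (past Y t) U' \<and>
            constructed_by M \<epsilon> (filter_functional U) (past Y (t + s)) Us \<and>
            in_L2 M (\<lambda>\<omega>. U' (\<lambda>j. Y j \<omega>) s - Us (\<lambda>j. Y j \<omega>) s) \<and>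
            norm_L2 M (\<lambda>\<omega>. U' (\<lambda>j. Y j \<omega>) s - Us (\<lambda>j. Y j \<omega>) s) < \<epsilon>)"
proof -
  interpret activation \<sigma> using assms by unfold_locales auto
  have Y: "Y k \<in> borel_measurable M" for k using assms(8)[of k] by (simp add: in_L2_def)
  \<comment> \<open>Measurability comes from the filter itself; square integrability is transferred
    from \<open>Y (k + 1)\<close> through almost sure equality.\<close>
  have U_L2: "in_L2 M (\<lambda>\<omega>. U (\<lambda>j. Y j \<omega>) k)" for k
  proof -
    have paths: "(\<lambda>\<omega> j. Y j \<omega>) \<in> M \<rightarrow>\<^sub>M paths" by (rule measurable_pathsI) (rule Y)
    have "(\<lambda>z. U z k) \<in> borel_measurable paths"
      using \<open>seq_filter U\<close> unfolding seq_filter_def by (rule measurable_compose[OF _ measurable_path_component])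
    from measurable_compose[OF paths this]
    have meas: "(\<lambda>\<omega>. U (\<lambda>j. Y j \<omega>) k) \<in> borel_measurable M" .
    have "integrable M (\<lambda>\<omega>. (norm (Y (k + 1) \<omega>))\<^sup>2)" using assms(8) by (simp add: in_L2_def)
    then have "integrable M (\<lambda>\<omega>. (norm (U (\<lambda>j. Y j \<omega>) k))\<^sup>2)"
      by (rule integrable_cong_AE_imp) (use meas assms(15)[of k] in auto)
    with meas show ?thesis by (simp add: in_L2_def)
  qed
  \<comment> \<open>One network is obtained for both times \<open>t\<close> and
    \<open>t + s\<close>; taking \<open>s = 0\<close> yields the first claim, general
    \<open>s\<close> the second.\<close>
  have main: "\<exists>N A Win \<zeta> w. 0 < N \<and> (\<forall>t'\<in>{t, t + s}.
      in_L2 M (\<lambda>\<omega>. filter_functional (esn_filter \<sigma> N (lower A) Win \<zeta> w) (past Y t' \<omega>)) \<and>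
      norm_L2 M (\<lambda>\<omega>. filter_functional U (past Y t' \<omega>)
        - filter_functional (esn_filter \<sigma> N (lower A) Win \<zeta> w) (past Y t' \<omega>)) < \<epsilon>)"
    if pos: "\<epsilon> > 0" for s \<epsilon>
  proof -
    have fin: "finite {t, t + s}" by simp
    obtain N A Win \<zeta> w where "0 < N"
      "\<And>t'. t' \<in> {t, t + s} \<Longrightarrow> in_L2 M (\<lambda>\<omega>. esn_filter \<sigma> N (lower A) Win \<zeta> w (\<lambda>j. Y j \<omega>) t')"
      "\<And>t'. t' \<in> {t, t + s} \<Longrightarrow>
        norm_L2 M (\<lambda>\<omega>. U (\<lambda>j. Y j \<omega>) t' - esn_filter \<sigma> N (lower A) Win \<zeta> w (\<lambda>j. Y j \<omega>) t') < \<epsilon>"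
      using esn_approximates_filter[OF assms(1) Y assms(12-14) U_L2 fin pos] by blast
    then show ?thesis
      using assms(13,14)
      by (intro exI[of _ N] exI[of _ A] exI[of _ Win] exI[of _ \<zeta>] exI[of _ w])
         (simp add: filter_functional_past causal_esn_lower time_invariant_esn_lower)
  qed
  note esn = echo_state_property_lower seq_filter_esn_lower[OF measurable_activation]
    causal_esn_lower time_invariant_esn_lower
  show ?thesis
  proof (intro conjI allI impI)
    fix \<epsilon> :: real assume "\<epsilon> > 0"
    from main[OF this, of 0] obtain N A Win \<zeta> w where "0 < N"
      "in_L2 M (\<lambda>\<omega>. filter_functional (esn_filter \<sigma> N (lower A) Win \<zeta> w) (past Y t \<omega>))"
      "norm_L2 M (\<lambda>\<omega>. filter_functional U (past Y t \<omega>)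
        - filter_functional (esn_filter \<sigma> N (lower A) Win \<zeta> w) (past Y t \<omega>)) < \<epsilon>"
      by auto
    then show "\<exists>N A Win \<zeta> w. 0 < N \<and>
            echo_state_property \<sigma> N A Win \<zeta> \<and>
            seq_filter (esn_filter \<sigma> N A Win \<zeta> w) \<and>
            causal (esn_filter \<sigma> N A Win \<zeta> w) \<and>
            time_invariant (esn_filter \<sigma> N A Win \<zeta> w) \<and>
            in_L2 M (\<lambda>\<omega>. filter_functional (esn_filter \<sigma> N A Win \<zeta> w) (past Y t \<omega>)) \<and>
            norm_L2 M (\<lambda>\<omega>. filter_functional U (past Y t \<omega>)
                          - filter_functional (esn_filter \<sigma> N A Win \<zeta> w) (past Y t \<omega>)) < \<epsilon>"
      by (intro exI[of _ N] exI[of _ "lower A"] exI[of _ Win] exI[of _ \<zeta>] exI[of _ w] conjI esn) auto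
  next
    fix s and \<epsilon> :: real assume "\<epsilon> > 0"
    from main[OF this, of s] obtain N A Win \<zeta> w where N: "0 < N"
      and approx: "\<forall>t'\<in>{t, t + s}.
        in_L2 M (\<lambda>\<omega>. filter_functional (esn_filter \<sigma> N (lower A) Win \<zeta> w) (past Y t' \<omega>)) \<and>
        norm_L2 M (\<lambda>\<omega>. filter_functional U (past Y t' \<omega>)
          - filter_functional (esn_filter \<sigma> N (lower A) Win \<zeta> w) (past Y t' \<omega>)) < \<epsilon>"
      by blast
    let ?V = "esn_filter \<sigma> N (lower A) Win \<zeta> w"
    have "is_esn_filter \<sigma> ?V" unfolding is_esn_filter_def using N esn by blast
    moreover have "constructed_by M \<epsilon> (filter_functional U) (past Y t) ?V"
      "constructed_by M \<epsilon> (filter_functional U) (past Y (t + s)) ?V"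
      using approx by (auto simp: constructed_by_def)
    \<comment> \<open>One network approximates at both times, so both filters may be taken equal.\<close>
    ultimately show "\<exists>U' Us.
            is_esn_filter \<sigma> U' \<and> causal U' \<and> time_invariant U' \<and>
            is_esn_filter \<sigma> Us \<and> causal Us \<and> time_invariant Us \<and>
            constructed_by M \<epsilon> (filter_functional U) (past Y t) U' \<and>
            constructed_by M \<epsilon> (filter_functional U) (past Y (t + s)) Us \<and>
            in_L2 M (\<lambda>\<omega>. U' (\<lambda>j. Y j \<omega>) s - Us (\<lambda>j. Y j \<omega>) s) \<and>
            norm_L2 M (\<lambda>\<omega>. U' (\<lambda>j. Y j \<omega>) s - Us (\<lambda>j. Y j \<omega>) s) < \<epsilon>"
      using \<open>\<epsilon> > 0\<close>
      by (intro exI[of _ ?V] conjI causal_esn_lower time_invariant_esn_lower)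
         (simp_all add: in_L2_def norm_L2_def)
  qed
qed

end
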